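(* Let $q$ be a prime power and let $T=T(q)$ be a finite simple group of Lie type belonging to one of the families listed below (with the stated conditions). Let $r$ be a prime dividing $|T|$ but not $q$, and let $R$ be a Sylow $r$-subgroup of $T$. Then $$|R|\le |T|^{(\lfloor \log_r(M)\rfloor+1)/K},$$ except in the exceptional cases listed below, where $K$ and $M$ are given as follows. Classical families: - $\mathrm{A}_n(q)$, $n\ge 1$, $(n,q)\notin\{(1,2),(1,3)\}$: $K=n$, $M=n+1$. - ${}^2\mathrm{A}_n(q)$, $n\ge 2$, $(n,q)\ne(2,2)$: $K=n/2$, and $M=2(n+1)$ if $n$ is even, $M=2n$ if $n$ is odd. - $\mathrm{B}_n(q)$, $n\ge 2$, $(n,q)\neq(2,2)$: $K=n$, $M=2n$. - $\mathrm{C}_n(q)$, $n\ge 3$, $q$ odd: $K=n$, $M=2n$. - $\mathrm{D}_n(q)$, $n\ge 4$: $K=n/2$, $M=2(n-1)$. - ${}^2\mathrm{D}_n(q)$, $n\ge 4$: $K=n/2$, $M=2n$. Exceptional families ($q$ is any prime power unless stated otherwise): - ${}^2\mathrm{B}_2(q)$, $q=2^{2m+1}$, $m\ge1$: $K=2$, $M=4$. - ${}^3\mathrm{D}_4(q)$: $K=6$, $M=12$. - $\mathrm{E}_6(q)$: $K=12$, $M=12$. - ${}^2\mathrm{E}_6(q)$: $K=12$, $M=18$. - $\mathrm{E}_7(q)$: $K=18$, $M=18$. - $\mathrm{E}_8(q)$: $K=29$, $M=30$. - $\mathrm{F}_4(q)$: $K=12$, $M=12$. - ${}^2\mathrm{F}_4(q)'$,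 $q=2^{2m+1}$, $m\ge0$: $K=6$, $M=12$. - $\mathrm{G}_2(q)$, $q\ge3$: $K=6$, $M=6$. - ${}^2\mathrm{G}_2(q)$, $q=3^{2m+1}$, $m\ge1$: $K=7/2$, $M=6$. Exceptional cases: $(q,r)=(3,13)$ for $T={}^3\mathrm{D}_4(3)$, $\mathrm{E}_6(3)$, $\mathrm{F}_4(3)$ or $\mathrm{G}_2(3)$; and $(q,r)=(2,31)$ for $T=\mathrm{E}_8(2)$.
   Context: The notation refers to the finite simple groups with the following orders, where $d$ is the number of diagonal outer automorphisms of $T$ and $(a,b)$ denotes the gcd. - $\mathrm{A}_n(q)=\mathrm{PSL}(n+1,q)$: $d|T|=q^{n(n+1)/2}\prod_{i=2}^{n+1}(q^i-1)$, $d=(n+1,q-1)$. - ${}^2\mathrm{A}_n(q)=\mathrm{PSU}(n+1,q)$ (matrices over $\mathbb F_{q^2}$): $d|T|=q^{n(n+1)/2}\prod_{i=2}^{n+1}(q^i-(-1)^i)$, $d=(n+1,q+1)$. - $\mathrm{B}_n(q)$ (odd-dimensional orthogonal, $\Omega(2n+1,q)$) and $\mathrm{C}_n(q)=\mathrm{PSp}(2n,q)$: $d|T|=q^{n^2}\prod_{i=1}^n(q^{2i}-1)$, $d=(2,q-1)$. - $\mathrm{D}_n(q)=\mathrm{P}\Omega^+(2n,q)$: $d|T|=q^{n(n-1)}(q^n-1)\prod_{i=1}^{n-1}(q^{2i}-1)$, $d=(4,q^n-1)$. - ${}^2\mathrm{D}_n(q)=\mathrm{P}\Omega^-(2n,q)$: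 $d|T|=q^{n(n-1)}(q^n+1)\prod_{i=1}^{n-1}(q^{2i}-1)$, $d=(4,q^n+1)$. - ${}^2\mathrm{B}_2(q)$: $|T|=q^2(q^2+1)(q-1)$. - ${}^3\mathrm{D}_4(q)$: $|T|=q^{12}(q^8+q^4+1)(q^6-1)(q^2-1)$. - $\mathrm{E}_6(q)$: $d|T|=q^{36}\prod_{i\in\{2,5,6,8,9,12\}}(q^i-1)$, $d=(3,q-1)$. - ${}^2\mathrm{E}_6(q)$: $d|T|=q^{36}(q^{12}-1)(q^9+1)(q^8-1)(q^6-1)(q^5+1)(q^2-1)$, $d=(3,q+1)$. - $\mathrm{E}_7(q)$: $d|T|=q^{63}\prod_{i\in\{2,6,8,10,12,14,18\}}(q^i-1)$, $d=(2,q-1)$. - $\mathrm{E}_8(q)$: $|T|=q^{120}\prod_{i\in\{2,8,12,14,18,20,24,30\}}(q^i-1)$. - $\mathrm{F}_4(q)$: $|T|=q^{24}\prod_{i\in\{2,6,8,12\}}(q^i-1)$. - ${}^2\mathrm{F}_4(q)'$: $|T|=q^{12}(q^6+1)(q^4-1)(q^3+1)(q-1)$ if $q>2$ (in which case ${}^2\mathrm{F}_4(q)'={}^2\mathrm{F}_4(q)$); for $q=2$ it is the Tits group, whose order is half the value of this expression. - $\mathrm{G}_2(q)$: $|T|=q^6(q^6-1)(q^2-1)$. - ${}^2\mathrm{G}_2(q)$: $|T|=q^3(q^3+1)(q-1)$. $\log_r$ denotes the logarithm to base $r$. *)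

theory Defs
  imports Complex_Main "HOL-Algebra.SimpleGroups" "HOL-Number_Theory.Prime_Powers"
begin

text \<open>
  Names of the families of finite simple groups of Lie type. The prefix \<open>Tw2\<close> or \<open>Tw3\<close> stands
  for the left superscript 2 or 3 of a twisted family, so \<open>Tw2A n\<close> is the family PSU(n+1,q) and
  \<open>Tw2F4\<close> is the family of the derived groups of the large Ree groups, whose member for q = 2 is
  the Tits group.
\<close>

datatype lie_family =
    LieA nat | Tw2A nat | LieB nat | LieC nat | LieD nat | Tw2D nat
  | Tw2B2 | Tw3D4 | LieE6 | Tw2E6 | LieE7 | LieE8 | LieF4 | Tw2F4 | LieG2 | Tw2G2

fun lie_admissible :: "lie_family \<Rightarrow> nat \<Rightarrow> bool" where
  "lie_admissible (LieA n) q \<longleftrightarrow> n \<ge> 1 \<and> (n, q) \<notin> {(1, 2), (1, 3)}"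
| "lie_admissible (Tw2A n) q \<longleftrightarrow> n \<ge> 2 \<and> (n, q) \<noteq> (2, 2)"
| "lie_admissible (LieB n) q \<longleftrightarrow> n \<ge> 2 \<and> (n, q) \<noteq> (2, 2)"
| "lie_admissible (LieC n) q \<longleftrightarrow> n \<ge> 3 \<and> odd q"
| "lie_admissible (LieD n) q \<longleftrightarrow> n \<ge> 4"
| "lie_admissible (Tw2D n) q \<longleftrightarrow> n \<ge> 4"
| "lie_admissible Tw2B2 q \<longleftrightarrow> (\<exists>m\<ge>1. q = 2 ^ (2 * m + 1))"
| "lie_admissible Tw3D4 q \<longleftrightarrow> True"
| "lie_admissible LieE6 q \<longleftrightarrow> True"
| "lie_admissible Tw2E6 q \<longleftrightarrow> True"
| "lie_admissible LieE7 q \<longleftrightarrow> True"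
| "lie_admissible LieE8 q \<longleftrightarrow> True"
| "lie_admissible LieF4 q \<longleftrightarrow> True"
| "lie_admissible Tw2F4 q \<longleftrightarrow> (\<exists>m\<ge>0. q = 2 ^ (2 * m + 1))"
| "lie_admissible LieG2 q \<longleftrightarrow> q \<ge> 3"
| "lie_admissible Tw2G2 q \<longleftrightarrow> (\<exists>m\<ge>1. q = 3 ^ (2 * m + 1))"

text \<open>
  The order of the simple group \<open>T\<close> in family \<open>X\<close> over the parameter \<open>q\<close> is
  \<open>lie_numerator X q / lie_denominator X q\<close>. The denominator is the number \<open>d\<close> of diagonal outer
  automorphisms, except for the Tits group, where it is the index 2 of the derived subgroup.
  Integers are used because of the signs and subtractions in the numerators.
\<close>

fun lie_denominator :: "lie_family \<Rightarrow> int \<Rightarrow> int" where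
  "lie_denominator (LieA n) q = gcd (int n + 1) (q - 1)"
| "lie_denominator (Tw2A n) q = gcd (int n + 1) (q + 1)"
| "lie_denominator (LieB n) q = gcd 2 (q - 1)"
| "lie_denominator (LieC n) q = gcd 2 (q - 1)"
| "lie_denominator (LieD n) q = gcd 4 (q ^ n - 1)"
| "lie_denominator (Tw2D n) q = gcd 4 (q ^ n + 1)"
| "lie_denominator Tw2B2 q = 1"
| "lie_denominator Tw3D4 q = 1"
| "lie_denominator LieE6 q = gcd 3 (q - 1)"
| "lie_denominator Tw2E6 q = gcd 3 (q + 1)"
| "lie_denominator LieE7 q = gcd 2 (q - 1)"
| "lie_denominator LieE8 q = 1"
| "lie_denominator LieF4 q = 1"
| "lie_denominator Tw2F4 q = (if q = 2 then 2 else 1)"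
| "lie_denominator LieG2 q = 1"
| "lie_denominator Tw2G2 q = 1"

fun lie_numerator :: "lie_family \<Rightarrow> int \<Rightarrow> int" where
  "lie_numerator (LieA n) q = q ^ (n * (n + 1) div 2) * (\<Prod>i=2..n+1. q ^ i - 1)"
| "lie_numerator (Tw2A n) q = q ^ (n * (n + 1) div 2) * (\<Prod>i=2..n+1. q ^ i - (- 1) ^ i)"
| "lie_numerator (LieB n) q = q ^ (n\<^sup>2) * (\<Prod>i=1..n. q ^ (2 * i) - 1)"
| "lie_numerator (LieC n) q = q ^ (n\<^sup>2) * (\<Prod>i=1..n. q ^ (2 * i) - 1)"
| "lie_numerator (LieD n) q = q ^ (n * (n - 1)) * (q ^ n - 1) * (\<Prod>i=1..n-1. q ^ (2 * i) - 1)"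
| "lie_numerator (Tw2D n) q = q ^ (n * (n - 1)) * (q ^ n + 1) * (\<Prod>i=1..n-1. q ^ (2 * i) - 1)"
| "lie_numerator Tw2B2 q = q ^ 2 * (q ^ 2 + 1) * (q - 1)"
| "lie_numerator Tw3D4 q = q ^ 12 * (q ^ 8 + q ^ 4 + 1) * (q ^ 6 - 1) * (q ^ 2 - 1)"
| "lie_numerator LieE6 q = q ^ 36 * (\<Prod>i\<in>{2, 5, 6, 8, 9, 12}. q ^ i - 1)"
| "lie_numerator Tw2E6 q =
     q ^ 36 * (q ^ 12 - 1) * (q ^ 9 + 1) * (q ^ 8 - 1) * (q ^ 6 - 1) * (q ^ 5 + 1) * (q ^ 2 - 1)"
| "lie_numerator LieE7 q = q ^ 63 * (\<Prod>i\<in>{2, 6, 8, 10, 12, 14, 18}. q ^ i - 1)"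
| "lie_numerator LieE8 q = q ^ 120 * (\<Prod>i\<in>{2, 8, 12, 14, 18, 20, 24, 30}. q ^ i - 1)"
| "lie_numerator LieF4 q = q ^ 24 * (\<Prod>i\<in>{2, 6, 8, 12}. q ^ i - 1)"
| "lie_numerator Tw2F4 q = q ^ 12 * (q ^ 6 + 1) * (q ^ 4 - 1) * (q ^ 3 + 1) * (q - 1)"
| "lie_numerator LieG2 q = q ^ 6 * (q ^ 6 - 1) * (q ^ 2 - 1)"
| "lie_numerator Tw2G2 q = q ^ 3 * (q ^ 3 + 1) * (q - 1)"

text \<open>
  The simple group \<open>X(q)\<close> enters only through its simplicity and its order, as specified by the
  order formula of its family. A few orders are shared by non-isomorphic simple groups (for
  instance \<open>B\<^sub>n(q)\<close> and \<open>C\<^sub>n(q)\<close> for odd \<open>q\<close> and \<open>n \<ge> 3\<close>, or \<open>A\<^sub>2(4)\<close> and \<open>A\<^sub>3(2)\<close>); the predicate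
  holds for each of these groups.
\<close>

definition simple_group_with_lie_order ::
    "lie_family \<Rightarrow> nat \<Rightarrow> ('a, 'b) monoid_scheme \<Rightarrow> bool" where
  "simple_group_with_lie_order X q T \<longleftrightarrow>
     primepow q \<and> lie_admissible X q \<and> simple_group T \<and> finite (carrier T) \<and>
     lie_denominator X (int q) * int (order T) = lie_numerator X (int q)"

definition sylow_subgroup :: "nat \<Rightarrow> 'a set \<Rightarrow> ('a, 'b) monoid_scheme \<Rightarrow> bool" where
  "sylow_subgroup r R T \<longleftrightarrow> subgroup R T \<and> card R = r ^ multiplicity r (order T)"

fun lie_K :: "lie_family \<Rightarrow> real" where
  "lie_K (LieA n) = real n"
| "lie_K (Tw2A n) = real n / 2"
| "lie_K (LieB n) = real n"
| "lie_K (LieC n) = real n"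
| "lie_K (LieD n) = real n / 2"
| "lie_K (Tw2D n) = real n / 2"
| "lie_K Tw2B2 = 2"
| "lie_K Tw3D4 = 6"
| "lie_K LieE6 = 12"
| "lie_K Tw2E6 = 12"
| "lie_K LieE7 = 18"
| "lie_K LieE8 = 29"
| "lie_K LieF4 = 12"
| "lie_K Tw2F4 = 6"
| "lie_K LieG2 = 6"
| "lie_K Tw2G2 = 7 / 2"

fun lie_M :: "lie_family \<Rightarrow> nat" where
  "lie_M (LieA n) = n + 1"
| "lie_M (Tw2A n) = (if even n then 2 * (n + 1) else 2 * n)"
| "lie_M (LieB n) = 2 * n"
| "lie_M (LieC n) = 2 * n"
| "lie_M (LieD n) = 2 * (n - 1)"
| "lie_M (Tw2D n) = 2 * n"
| "lie_M Tw2B2 = 4"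
| "lie_M Tw3D4 = 12"
| "lie_M LieE6 = 12"
| "lie_M Tw2E6 = 18"
| "lie_M LieE7 = 18"
| "lie_M LieE8 = 30"
| "lie_M LieF4 = 12"
| "lie_M Tw2F4 = 12"
| "lie_M LieG2 = 6"
| "lie_M Tw2G2 = 6"

definition lie_exceptional_case :: "lie_family \<Rightarrow> nat \<Rightarrow> nat \<Rightarrow> bool" where
  "lie_exceptional_case X q r \<longleftrightarrow>
     X \<in> {Tw3D4, LieE6, LieF4, LieG2} \<and> q = 3 \<and> r = 13 \<or> X = LieE8 \<and> q = 2 \<and> r = 31"

end

theory Submission
  imports Defs "HOL-Number_Theory.Cong"
begin

text \<open>
  Only the order formula matters. Let \<open>r\<close> be a prime that does not divide \<open>q\<close>, and let \<open>k\<close> be the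
  multiplicative order of \<open>q\<close> modulo \<open>r\<close>. Then \<open>r\<close> divides \<open>q ^ i - 1\<close> only if \<open>k\<close> divides \<open>i\<close>, and by
  lifting the exponent (\<open>multiplicity_power_minus_one_le\<close>) the multiplicity of \<open>r\<close> in \<open>q ^ i - 1\<close>
  is then at most \<open>a\<close> plus the multiplicity of \<open>r\<close> in \<open>i\<close>, where \<open>r ^ a\<close> is the \<open>r\<close>-part of
  \<open>q ^ k - 1\<close>. The prime 2 behaves in the same way if 4 divides \<open>q - 1\<close>, and needs a variant
  (\<open>multiplicity_2_power_minus_one\<close>) otherwise.

  Classical families: the multiplicity of \<open>r\<close> in an index \<open>i \<le> m\<close> is at most \<open>L\<close>, the largest
  exponent with \<open>r ^ L \<le> m\<close>, so each of the at most \<open>m / k\<close> relevant factors contributes at most \<open>a (L + 1)\<close>.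
  As \<open>r ^ a < q ^ k\<close>, the \<open>r\<close>-part of the product of all \<open>q ^ i - 1\<close> with \<open>i \<le> m\<close> is at most
  \<open>(q ^ m) ^ (L + 1)\<close> (\<open>prime_power_dvd_prod_power_minus_one\<close>). For \<open>A\<^sub>n\<close>, \<open>B\<^sub>n\<close> and \<open>C\<^sub>n\<close>
  the numerator of the order, without its power of \<open>q\<close>, divides such a product; for \<open>\<^sup>2A\<^sub>n\<close> it does so after
  replacing \<open>q\<close> by \<open>-q\<close>, with \<open>q\<^sup>2\<close> in the bound, and for \<open>D\<^sub>n\<close> and \<open>\<^sup>2D\<^sub>n\<close> up to one
  factor that is estimated trivially. The bases of the resulting \<open>(L + 1)\<close>-st powers are at most
  \<open>|T| ^ (1 / K)\<close> because the product of the \<open>1 - q ^ -i\<close> over \<open>i \<ge> 2\<close> is at least one half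
  (\<open>prod_power_minus_one_lower\<close>).

  Exceptional families other than \<open>\<^sup>2B\<^sub>2\<close> and \<open>\<^sup>2G\<^sub>2\<close>: here \<open>K\<close> is so large that
  \<open>q ^ k - 1\<close> has to be replaced by its cyclotomic factor \<open>\<Phi>\<^sub>k(q)\<close>, which contains the whole
  \<open>r\<close>-part. If \<open>D\<close> lists the degrees and \<open>e\<close> of them are divisible by \<open>k\<close>, the
  \<open>r\<close>-part of the order is at most \<open>\<Phi>\<^sub>k(q) ^ e\<close> times the \<open>r\<close>-part of the product of \<open>D\<close>
  (\<open>odd_prime_power_dvd_degree_product\<close>). For \<open>r > M\<close> the second factor is 1, and
  \<open>\<Phi>\<^sub>k(q) ^ (e K) \<le> |T|\<close> holds whenever \<open>\<Phi>\<^sub>k(q)\<close> has a prime factor above \<open>M\<close>, apart from the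
  excluded cases; for \<open>q \<ge> 7\<close> this is an estimate of leading terms, for \<open>q < 7\<close> a finite check.
  For \<open>r \<le> M\<close> the bound allows at least the square of \<open>|T| ^ (1 / K)\<close>, and crude estimates
  are enough (\<open>exceptional_power_bound_numeric\<close>). For \<open>\<^sup>2B\<^sub>2\<close> and \<open>\<^sup>2G\<^sub>2\<close> the
  order splits into factors that are coprime up to 2 and 3, and no lifting is needed.
\<close>

section \<open>Lifting the exponent\<close>

lemma geometric_sum_cong:
  fixes y p :: int
  assumes "p dvd y - 1"
  shows "[(\<Sum>i<n. y ^ i) = int n] (mod p)"
proof -
  have "[y = 1] (mod p)" using assms by (simp add: cong_iff_dvd_diff)
  then have "[y ^ i = 1] (mod p)" for i using cong_pow[of y 1 p i] by simp
  then have "[(\<Sum>i<n. y ^ i) = (\<Sum>i<n. 1)] (mod p)" by (intro cong_sum) auto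
  then show ?thesis by simp
qed

lemma geometric_sum_not_dvd_square:
  fixes y :: int and p :: nat
  assumes p: "prime p" and dvd: "int p dvd y - 1" and two: "p = 2 \<Longrightarrow> 4 dvd y - 1"
  shows "\<not> (int p)\<^sup>2 dvd (\<Sum>i<p. y ^ i)"
proof (cases "p = 2")
  case True
  have "(\<Sum>i<p. y ^ i) = (y - 1) + 2" using True by (simp add: numeral_2_eq_2)
  then show ?thesis using two[OF True] True by simp presburger
next
  case False
  from dvd obtain t where t: "y = 1 + int p * t" by (auto simp: dvd_def algebra_simps)
  have pow: "[y ^ i = 1 + int i * (int p * t)] (mod (int p)\<^sup>2)" for i
  proof (induction i)
    case (Suc i)
    have "[y * y ^ i = y * (1 + int i * (int p * t))] (mod (int p)\<^sup>2)"
      by (intro cong_mult cong_refl Suc)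
    moreover have "y * (1 + int i * (int p * t))
        = 1 + int (Suc i) * (int p * t) + (int p)\<^sup>2 * (int i * t\<^sup>2)"
      by (simp add: t algebra_simps power2_eq_square)
    ultimately show ?case by (simp add: cong_def)
  qed simp
  have "[(\<Sum>i<p. y ^ i) = (\<Sum>i<p. 1 + int i * (int p * t))] (mod (int p)\<^sup>2)"
    by (intro cong_sum pow)
  also have "(\<Sum>i<p. 1 + int i * (int p * t)) = int p + (\<Sum>i<p. int i) * (int p * t)"
    by (simp add: sum.distrib sum_distrib_right)
  also have "(\<Sum>i<p. int i) = int p * ((int p - 1) div 2)"
  proof -
    have gauss: "2 * (\<Sum>i<n. int i) = int n * (int n - 1)" for n
      by (induction n) (auto simp: algebra_simps)
    have "odd p" using False p prime_odd_nat prime_ge_2_nat by (metis le_neq_implies_less)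
    then obtain c where "p = 2 * c + 1" by (elim oddE)
    then show ?thesis using gauss[of p] by simp
  qed
  also have "int p + int p * ((int p - 1) div 2) * (int p * t)
      = int p + (int p)\<^sup>2 * ((int p - 1) div 2 * t)"
    by (simp add: power2_eq_square)
  finally have cong: "[(\<Sum>i<p. y ^ i) = int p] (mod (int p)\<^sup>2)" by (simp add: cong_def)
  have "\<not> (int p)\<^sup>2 dvd int p"
  proof
    assume "(int p)\<^sup>2 dvd int p"
    then have "(int p)\<^sup>2 \<le> int p" using zdvd_imp_le[of "(int p)\<^sup>2" "int p"] prime_gt_0_nat[OF p] by simp
    then have "int p \<le> 1" using prime_gt_0_nat[OF p] by (simp add: power2_eq_square)
    then show False using prime_ge_2_nat[OF p] by simp
  qed
  then show ?thesis using cong cong_dvd_iff by blast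
qed

lemma power_minus_one_neq_0:
  fixes x :: int
  assumes "\<bar>x\<bar> \<ge> 2" "n > 0"
  shows "x ^ n - 1 \<noteq> 0"
proof
  assume "x ^ n - 1 = 0"
  then have "\<bar>x\<bar> ^ n = 1" by (metis abs_1 eq_iff_diff_eq_0 power_abs)
  moreover have "\<bar>x\<bar> ^ n > 1" using assms by (intro one_less_power) auto
  ultimately show False by simp
qed

text \<open>One half of the lifting-the-exponent lemma.\<close>

lemma multiplicity_power_minus_one_le:
  fixes x :: int and p n :: nat
  assumes p: "prime p" and x: "\<bar>x\<bar> \<ge> 2" and dvd: "int p dvd x - 1"
    and two: "p = 2 \<Longrightarrow> 4 dvd x - 1" and n: "n > 0"
  shows "multiplicity (int p) (x ^ n - 1)
           \<le> multiplicity (int p) (x - 1) + multiplicity p n"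
  using n
proof (induction n rule: less_induct)
  case (less n)
  have pe: "prime_elem (int p)" using p by simp
  have nu: "\<not> is_unit (int p)" using prime_gt_1_nat[OF p] by simp
  show ?case
  proof (cases "p dvd n")
    case False
    let ?S = "\<Sum>i<n. x ^ i"
    have eq: "x ^ n - 1 = (x - 1) * ?S" by (simp add: power_diff_1_eq)
    then have nz: "x - 1 \<noteq> 0" "?S \<noteq> 0" using power_minus_one_neq_0[OF x less.prems] by auto
    have "\<not> int p dvd ?S"
      using cong_dvd_iff[OF geometric_sum_cong[OF dvd, of n]] False by simp
    then have "multiplicity (int p) ?S = 0" by (rule not_dvd_imp_multiplicity_0)
    then show ?thesis unfolding eq using nz by (simp add: prime_elem_multiplicity_mult_distrib[OF pe])
  next
    case True
    then obtain m where m: "n = p * m" by (elim dvdE)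
    have m0: "m > 0" using less.prems m by (cases m) auto
    have mn: "m < n" using m m0 prime_gt_1_nat[OF p] by simp
    let ?y = "x ^ m"
    let ?S = "\<Sum>i<p. ?y ^ i"
    have eq: "x ^ n - 1 = (?y - 1) * ?S"
      unfolding m mult.commute[of p] power_mult by (rule power_diff_1_eq)
    then have nz: "?y - 1 \<noteq> 0" "?S \<noteq> 0" using power_minus_one_neq_0[OF x less.prems] by auto
    have xy: "x - 1 dvd ?y - 1" by (simp add: power_diff_1_eq)
    have "\<not> (int p)\<^sup>2 dvd ?S"
    proof (rule geometric_sum_not_dvd_square[OF p])
      show "int p dvd ?y - 1" using dvd xy dvd_trans by blast
      show "4 dvd ?y - 1" if "p = 2" using two[OF that] xy dvd_trans by blast
    qed
    then have S: "multiplicity (int p) ?S < 2" using multiplicity_lessI nz nu by blast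
    have "multiplicity p n = Suc (multiplicity p m)"
      unfolding m using multiplicity_times_same[of m p] m0 prime_gt_1_nat[OF p] by simp
    then show ?thesis
      unfolding eq using nz S less.IH[OF mn m0]
      by (simp add: prime_elem_multiplicity_mult_distrib[OF pe])
  qed
qed

text \<open>
  The multiplicities of a prime \<open>p\<close> in the numbers \<open>x ^ i - 1\<close> are governed by the
  multiplicative order \<open>k\<close> of \<open>x\<close> modulo \<open>p\<close>.
\<close>

lemma multiplicity_power_minus_one_order:
  fixes x :: int and p :: nat
  assumes p: "prime p" and x: "\<bar>x\<bar> \<ge> 2" and nd: "\<not> int p dvd x"
    and two: "p = 2 \<Longrightarrow> 4 dvd x - 1" and ex: "\<exists>i>0. int p dvd x ^ i - 1"
  obtains k where "k > 0" "int p dvd x ^ k - 1"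
    "\<And>i. 0 < i \<Longrightarrow> i < k \<Longrightarrow> \<not> int p dvd x ^ i - 1"
    "\<And>i. i > 0 \<Longrightarrow> k dvd i \<Longrightarrow> multiplicity (int p) (x ^ i - 1)
        \<le> multiplicity (int p) (x ^ k - 1) + multiplicity p i"
    "\<And>i. \<not> k dvd i \<Longrightarrow> \<not> int p dvd x ^ i - 1"
proof -
  define k where "k = (LEAST i. i > 0 \<and> int p dvd x ^ i - 1)"
  have k: "k > 0 \<and> int p dvd x ^ k - 1" unfolding k_def by (rule LeastI_ex) (use ex in blast)
  have min: "\<not> int p dvd x ^ i - 1" if "0 < i" "i < k" for i
    using that not_less_Least unfolding k_def by blast
  have ndvd: "\<not> int p dvd x ^ i - 1" if "\<not> k dvd i" for i
  proof
    assume i: "int p dvd x ^ i - 1"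
    have 1: "[x ^ k = 1] (mod int p)" using k by (simp add: cong_iff_dvd_diff)
    have "x ^ i = (x ^ k) ^ (i div k) * x ^ (i mod k)"
      by (simp flip: power_mult power_add)
    moreover have "[(x ^ k) ^ (i div k) * x ^ (i mod k) = 1 ^ (i div k) * x ^ (i mod k)] (mod int p)"
      by (intro cong_mult cong_pow 1 cong_refl)
    ultimately have "[x ^ i = x ^ (i mod k)] (mod int p)" by simp
    moreover have "[x ^ i = 1] (mod int p)" using i by (simp add: cong_iff_dvd_diff)
    ultimately have "[x ^ (i mod k) = 1] (mod int p)" using cong_trans cong_sym by blast
    then have "int p dvd x ^ (i mod k) - 1" by (simp add: cong_iff_dvd_diff)
    moreover have "0 < i mod k" "i mod k < k" using that k by (auto simp: dvd_eq_mod_eq_0)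
    ultimately show False using min by blast
  qed
  have le: "multiplicity (int p) (x ^ i - 1)
        \<le> multiplicity (int p) (x ^ k - 1) + multiplicity p i" if i: "i > 0" "k dvd i" for i
  proof -
    obtain j where j: "i = k * j" using i by (elim dvdE)
    have j0: "j > 0" using i j by (cases j) auto
    have "\<bar>x ^ k\<bar> \<ge> 2"
    proof -
      have "\<bar>x\<bar> ^ 1 \<le> \<bar>x\<bar> ^ k" using x k by (intro power_increasing) auto
      then show ?thesis using x by (simp add: power_abs)
    qed
    moreover have "4 dvd x ^ k - 1" if "p = 2"
    proof -
      have "x - 1 dvd x ^ k - 1" by (simp add: power_diff_1_eq)
      then show ?thesis using two[OF that] dvd_trans by blast
    qed
    ultimately have "multiplicity (int p) ((x ^ k) ^ j - 1)
        \<le> multiplicity (int p) (x ^ k - 1) + multiplicity p j"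
      using multiplicity_power_minus_one_le[OF p, of "x ^ k" j] k j0 by blast
    moreover have "multiplicity p j \<le> multiplicity p i"
      using i j by (intro dvd_imp_multiplicity_le) auto
    ultimately show ?thesis by (simp add: j power_mult)
  qed
  show ?thesis using that[of k] k min le ndvd by blast
qed

text \<open>For the prime 2 this leaves the case that 4 divides \<open>x + 1\<close>.\<close>

lemma multiplicity_2_power_minus_one:
  fixes x :: int
  assumes x: "\<bar>x\<bar> \<ge> 2" and four: "4 dvd x + 1" and i: "i > 0"
  shows "multiplicity 2 (x ^ i - 1)
     \<le> (if even i then multiplicity 2 (x + 1) + multiplicity 2 i else 1)"
proof (cases "even i")
  case True
  then obtain j where j: "i = 2 * j" by (elim evenE)
  have j0: "j > 0" using i j by simp
  obtain c where c: "x = 4 * c - 1" using four by (auto simp: dvd_def algebra_simps)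
  have nz: "x + 1 \<noteq> 0" "x - 1 \<noteq> 0" using x by auto
  have pe: "prime_elem (2::int)" by simp
  have sq: "x\<^sup>2 - 1 = (x - 1) * (x + 1)" by (simp add: algebra_simps power2_eq_square)
  have "\<bar>x\<^sup>2\<bar> \<ge> 2"
  proof -
    have "\<bar>x\<bar> ^ 1 \<le> \<bar>x\<bar> ^ 2" using x by (intro power_increasing) auto
    then show ?thesis using x by (simp add: power_abs)
  qed
  moreover have "4 dvd x\<^sup>2 - 1" using four unfolding sq by simp
  ultimately have "multiplicity (int 2) ((x\<^sup>2) ^ j - 1)
      \<le> multiplicity (int 2) (x\<^sup>2 - 1) + multiplicity 2 j"
    using multiplicity_power_minus_one_le[of 2 "x\<^sup>2" j] j0 by (auto dest: dvd_trans[of 2 4, rotated])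
  moreover have "multiplicity 2 i = Suc (multiplicity 2 j)"
    unfolding j using multiplicity_times_same[of j "2::nat"] j0 by simp
  moreover have "multiplicity 2 (x\<^sup>2 - 1) = multiplicity 2 (x - 1) + multiplicity 2 (x + 1)"
    unfolding sq using nz by (simp add: prime_elem_multiplicity_mult_distrib[OF pe])
  moreover have "multiplicity 2 (x - 1) < 2"
    using nz by (intro multiplicity_lessI) (auto simp: c, presburger)
  ultimately show ?thesis using True by (simp add: j power_mult)
next
  case False
  have "[x = -1] (mod 4)" using four by (simp add: cong_iff_dvd_diff)
  then have "[x ^ i = (-1) ^ i] (mod 4)" by (rule cong_pow)
  then have "[x ^ i = -1] (mod 4)" using False by simp
  then have "\<not> 2\<^sup>2 dvd x ^ i - 1" by (simp add: cong_iff_dvd_diff) presburger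
  then have "multiplicity 2 (x ^ i - 1) < 2"
    using power_minus_one_neq_0[OF x i] by (intro multiplicity_lessI) auto
  then show ?thesis using False by simp
qed

section \<open>Prime parts of products of powers minus one\<close>

lemma sum_indicator_multiples:
  "(\<Sum>i=1..m. if k dvd i then c else 0) = (m div k) * (c::nat)"
  by (induction m) (auto simp: div_Suc dvd_eq_mod_eq_0)

lemma sum_even_odd:
  "(\<Sum>i=1..m. if even i then c else 1) = (m div 2) * (c::nat) + (m + 1) div 2"
  by (induction m) (auto simp: div_Suc mod2_eq_if)

text \<open>
  The base \<open>x\<close> may be negative, as needed for unitary groups. The separate base \<open>z\<close> of the bound
  leaves room for \<open>|x ^ k - 1| = |x| ^ k + 1\<close> in that case.
\<close>

lemma prime_power_dvd_prod_power_minus_one: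
  fixes x :: int and z m p v :: nat
  assumes p: "prime p" and x: "\<bar>x\<bar> \<ge> 2" and nd: "\<not> int p dvd x" and z: "z \<ge> 2"
    and bound: "\<And>k. k > 0 \<Longrightarrow> \<bar>x ^ k - 1\<bar> \<le> int z ^ k"
    and m: "m \<ge> 1" and dvd: "int p ^ v dvd (\<Prod>i=1..m. x ^ i - 1)"
  shows "\<exists>L. p ^ L \<le> m \<and> p ^ v \<le> (z ^ m) ^ (L + 1)"
proof -
  have pe: "prime_elem (int p)" using p by simp
  have nu: "\<not> is_unit (int p)" using prime_gt_1_nat[OF p] by simp
  obtain L where L: "p ^ L \<le> m" "m < p ^ (L + 1)"
    using ex_power_ivl1[OF prime_ge_2_nat[OF p] m] by auto
  have mult_le: "multiplicity p i \<le> L" if "i \<in> {1..m}" for i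
  proof -
    have "p ^ multiplicity p i \<le> i" using that by (intro dvd_imp_le multiplicity_dvd) auto
    also have "i < p ^ (L + 1)" using that L by simp
    finally have "multiplicity p i < L + 1"
      using prime_gt_1_nat[OF p] by (meson power_less_imp_less_exp)
    then show ?thesis by simp
  qed
  have nz: "x ^ i - 1 \<noteq> 0" if "i \<in> {1..m}" for i using power_minus_one_neq_0[OF x] that by simp
  have "(\<Prod>i=1..m. x ^ i - 1) \<noteq> 0" using nz by simp
  then have "v \<le> multiplicity (int p) (\<Prod>i=1..m. x ^ i - 1)"
    using dvd multiplicity_geI nu by blast
  also have "\<dots> = (\<Sum>i=1..m. multiplicity (int p) (x ^ i - 1))"
    using nz by (intro prime_elem_multiplicity_prod_distrib[OF pe]) force+
  finally have v: "v \<le> (\<Sum>i=1..m. multiplicity (int p) (x ^ i - 1))" .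
  have mono: "p ^ v \<le> p ^ w" if "v \<le> w" for w
    using that prime_gt_0_nat[OF p] by (intro power_increasing) auto
  have pow_le: "p ^ a \<le> z ^ k" if "int p ^ a dvd x ^ k - 1" "k > 0" for a k
  proof -
    have "int p ^ a \<le> \<bar>x ^ k - 1\<bar>"
      using that power_minus_one_neq_0[OF x that(2)] by (intro zdvd_imp_le) auto
    then have "int (p ^ a) \<le> int (z ^ k)" using bound[OF that(2)] by simp
    then show ?thesis by (simp only: of_nat_le_iff)
  qed
  have "p ^ v \<le> (z ^ m) ^ (L + 1)"
  proof (cases "p = 2 \<longrightarrow> 4 dvd x - 1")
    case True
    show ?thesis
    proof (cases "\<exists>i>0. int p dvd x ^ i - 1")
      case ex: True
      obtain k where k: "k > 0" "int p dvd x ^ k - 1"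
        "\<And>i. i > 0 \<Longrightarrow> k dvd i \<Longrightarrow> multiplicity (int p) (x ^ i - 1)
            \<le> multiplicity (int p) (x ^ k - 1) + multiplicity p i"
        "\<And>i. \<not> k dvd i \<Longrightarrow> \<not> int p dvd x ^ i - 1"
        using multiplicity_power_minus_one_order[OF p x nd _ ex] True by metis
      define a where "a = multiplicity (int p) (x ^ k - 1)"
      have a1: "a \<ge> 1" unfolding a_def
        using k power_minus_one_neq_0[OF x k(1)] nu by (intro multiplicity_geI) auto
      have "multiplicity (int p) (x ^ i - 1) \<le> (if k dvd i then a * (L + 1) else 0)"
        if i: "i \<in> {1..m}" for i
      proof (cases "k dvd i")
        case True
        have "multiplicity (int p) (x ^ i - 1) \<le> a + multiplicity p i"
          using k(3)[of i] i True by (simp add: a_def)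
        also have "\<dots> \<le> a + a * L" using mult_le[OF i] a1 by (simp add: le_trans)
        finally show ?thesis using True by simp
      next
        case False
        then show ?thesis using not_dvd_imp_multiplicity_0[OF k(4)] by simp
      qed
      then have "v \<le> (\<Sum>i=1..m. if k dvd i then a * (L + 1) else 0)"
        using v by (intro le_trans[OF v] sum_mono) auto
      then have "v \<le> a * (m div k) * (L + 1)"
        unfolding sum_indicator_multiples by (simp only: mult_ac)
      then have "p ^ v \<le> ((p ^ a) ^ (m div k)) ^ (L + 1)"
        unfolding power_mult[symmetric] by (rule mono)
      also have "\<dots> \<le> ((z ^ k) ^ (m div k)) ^ (L + 1)"
        using pow_le[of a k] k(1) by (intro power_mono) (auto simp: a_def multiplicity_dvd)
      also have "\<dots> \<le> (z ^ m) ^ (L + 1)"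
        unfolding power_mult[of z k, symmetric] using z by (intro power_mono power_increasing) auto
      finally show ?thesis .
    next
      case False
      have "multiplicity (int p) (x ^ i - 1) \<le> 0" if "i \<in> {1..m}" for i
      proof -
        have "i > 0" using that by simp
        then have "\<not> int p dvd x ^ i - 1" using False by blast
        then have "multiplicity (int p) (x ^ i - 1) = 0" by (rule not_dvd_imp_multiplicity_0)
        then show ?thesis by simp
      qed
      then have "v \<le> (\<Sum>i=1..m. 0)" by (intro le_trans[OF v] sum_mono)
      then show ?thesis using z by simp
    qed
  next
    case False
    then have p2: "p = 2" and "odd x" using nd by auto
    \<comment> \<open>Odd indices contribute 1 each and even ones up to \<open>w + L\<close>. The part \<open>w\<close> is paid for by
      \<open>z ^ m\<close>, since \<open>2 ^ w\<close> divides \<open>x ^ 2 - 1\<close>; all the rest is at most \<open>m L\<close> if \<open>L \<ge> 1\<close>.\<close>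
    then have four: "4 dvd x + 1" using False by presburger
    define w where "w = multiplicity 2 (x + 1)"
    have "multiplicity (int p) (x ^ i - 1) \<le> (if even i then w + L else 1)"
      if i: "i \<in> {1..m}" for i
      using multiplicity_2_power_minus_one[OF x four, of i] mult_le[OF i] i
      by (auto simp: w_def p2)
    then have "v \<le> (\<Sum>i=1..m. if even i then w + L else 1)"
      by (intro le_trans[OF v] sum_mono) auto
    then have v2: "v \<le> (m div 2) * w + ((m div 2) * L + (m + 1) div 2)"
      unfolding sum_even_odd by (simp add: algebra_simps)
    have "(m div 2) * L + (m + 1) div 2 \<le> m * (L + 1) - (m div 2) * 2 \<and> (m div 2) * 2 \<le> m"
    proof (cases L)
      case 0
      then have "m = 1" using L m p2 by simp
      then show ?thesis by simp
    next
      case (Suc l)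
      define d e where "d = (m + 1) div 2" and "e = m div 2"
      have m_eq: "m = e + d" and e: "e * 2 \<le> m" by (simp_all add: d_def e_def)
      have "d * 1 \<le> d * L" using Suc by (intro mult_left_mono) auto
      then have "e * L + d \<le> m * L" by (simp add: m_eq add_mult_distrib)
      moreover have "m * L \<le> m * (L + 1) - e * 2" using e by (simp add: algebra_simps)
      ultimately show ?thesis using e unfolding d_def e_def by linarith
    qed
    then obtain s where s: "s = m * (L + 1) - (m div 2) * 2" "(m div 2) * L + (m + 1) div 2 \<le> s"
      "(m div 2) * 2 + s = m * (L + 1)" by fastforce
    have "int 2 ^ w dvd x ^ 2 - 1"
    proof -
      have "2 ^ w dvd x + 1" unfolding w_def by (rule multiplicity_dvd)
      moreover have "x ^ 2 - 1 = (x + 1) * (x - 1)" by (simp add: algebra_simps power2_eq_square)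
      ultimately show ?thesis by simp
    qed
    then have w: "2 ^ w \<le> z ^ 2" using pow_le[of w 2] p2 by simp
    have "v \<le> (m div 2) * w + s" using v2 s(2) by linarith
    then have "p ^ v \<le> 2 ^ ((m div 2) * w + s)" unfolding p2 by (intro power_increasing) auto
    also have "\<dots> = (2 ^ w) ^ (m div 2) * 2 ^ s" by (simp add: power_add mult.commute flip: power_mult)
    also have "\<dots> \<le> (z ^ 2) ^ (m div 2) * z ^ s" using w z by (intro mult_mono power_mono) auto
    also have "\<dots> = z ^ ((m div 2) * 2 + s)" by (simp add: power_add mult.commute flip: power_mult)
    also have "\<dots> = (z ^ m) ^ (L + 1)" unfolding s(3) by (rule power_mult)
    finally show ?thesis .
  qed
  then show ?thesis using L by blast
qed

text \<open>
  By the Weierstrass inequality the product of the \<open>1 - q ^ -i\<close> over \<open>S\<close> is at least one minus the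
  sum of the \<open>2 ^ -i\<close> over \<open>i \<ge> 2\<close>, which is one half.
\<close>

lemma prod_power_minus_one_lower:
  fixes q :: int and S :: "nat set"
  assumes q: "q \<ge> 2" and fin: "finite S" and S: "S \<subseteq> {2..}"
  shows "q ^ \<Sum>S \<le> 2 * (\<Prod>i\<in>S. q ^ i - 1)"
proof -
  define t :: "nat \<Rightarrow> real" where "t i = (1 / of_int q) ^ i" for i
  have t: "0 \<le> t i \<and> t i \<le> 1" for i using q by (simp add: t_def power_le_one)
  have weierstrass: "1 - sum t A \<le> (\<Prod>i\<in>A. 1 - t i)" if "finite A" for A
    using that
  proof (induction A)
    case (insert a A)
    have "(1 - t a) * (1 - sum t A) \<le> (1 - t a) * (\<Prod>i\<in>A. 1 - t i)"
      using insert t by (intro mult_left_mono) auto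
    moreover have "t a * sum t A \<ge> 0" using t by (simp add: sum_nonneg)
    ultimately show ?case using insert by (simp add: algebra_simps)
  qed simp
  have geo: "(\<Sum>i\<in>{2..<n+2}. (1/2::real) ^ i) = 1/2 - (1/2) ^ (n + 1)" for n
    by (induction n) (auto simp: sum.atLeastLessThan_Suc)
  obtain n where "\<forall>i\<in>S. i < n" using fin finite_nat_set_iff_bounded by blast
  then have "S \<subseteq> {2..<n+2}" using S by force
  have "sum t S \<le> (\<Sum>i\<in>S. (1/2) ^ i)"
    unfolding t_def using q by (intro sum_mono power_mono) (auto simp: divide_simps)
  also have "\<dots> \<le> (\<Sum>i\<in>{2..<n+2}. (1/2) ^ i)"
    using \<open>S \<subseteq> {2..<n+2}\<close> by (intro sum_mono2) auto
  also have "\<dots> \<le> 1/2" unfolding geo by simp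
  finally have half: "1/2 \<le> (\<Prod>i\<in>S. 1 - t i)" using weierstrass[OF fin] by linarith
  have "of_int (\<Prod>i\<in>S. q ^ i - 1) = (\<Prod>i\<in>S. of_int q ^ i * (1 - t i))"
    unfolding of_int_prod t_def using q
    by (intro prod.cong) (auto simp: power_one_over field_simps)
  also have "\<dots> = of_int q ^ \<Sum>S * (\<Prod>i\<in>S. 1 - t i)"
    by (simp add: prod.distrib power_sum)
  also have "\<dots> \<ge> of_int q ^ \<Sum>S * (1/2)" using half q by (intro mult_left_mono) auto
  finally have "real_of_int (q ^ \<Sum>S) \<le> real_of_int (2 * (\<Prod>i\<in>S. q ^ i - 1))" by simp
  then show ?thesis by (simp only: of_int_le_iff)
qed

text \<open>
  The passage from natural numbers to real powers. Any \<open>L\<close> with \<open>r ^ L \<le> M\<close> is at most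
  \<open>\<lfloor>log r M\<rfloor>\<close>, and \<open>K\<close> is written as a fraction \<open>m / p\<close> because it is half an integer
  for some families.
\<close>

lemma powr_bound_of_power_bound:
  fixes c N r L M m p :: nat
  assumes le: "c ^ m \<le> N ^ (p * (L + 1))" and "m > 0" "p > 0" "N \<ge> 1" "r \<ge> 2"
    and L: "r ^ L \<le> M" and K: "K = real m / real p"
  shows "real c \<le> real N powr (real_of_int (\<lfloor>log (real r) (real M)\<rfloor> + 1) / K)"
proof -
  let ?e = "real (L + 1) / K"
  have "(real N powr ?e) ^ m = real N powr (?e * real m)"
    using assms by (simp add: powr_realpow powr_powr flip: powr_realpow)
  also have "?e * real m = real (p * (L + 1))" using assms by (simp add: K field_simps)
  also have "real N powr real (p * (L + 1)) = real N ^ (p * (L + 1))"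
    using assms by (subst powr_realpow) auto
  finally have "real c ^ m \<le> (real N powr ?e) ^ m"
    using le by (metis of_nat_le_iff of_nat_power)
  then have "real c \<le> real N powr ?e" using assms by (subst (asm) power_mono_iff) auto
  also have "\<dots> \<le> real N powr (real_of_int (\<lfloor>log (real r) (real M)\<rfloor> + 1) / K)"
  proof (intro powr_mono divide_right_mono)
    have "real r ^ L \<le> real M" using L by (metis of_nat_le_iff of_nat_power)
    then have "real L \<le> log (real r) (real M)" using assms by (intro le_log_of_power) auto
    then have "int L \<le> \<lfloor>log (real r) (real M)\<rfloor>" by (simp add: le_floor_iff)
    then show "real (L + 1) \<le> real_of_int (\<lfloor>log (real r) (real M)\<rfloor> + 1)" by linarith
  qed (use assms in auto)
  finally show ?thesis .
qed

text \<open>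
  The bound \<open>s \<le> N ^ ((L + 1) / K)\<close> for the family \<open>X\<close>, cleared of fractional exponents, with
  some \<open>L\<close> not exceeding \<open>\<lfloor>log r M\<rfloor>\<close>.
\<close>

definition power_bound :: "lie_family \<Rightarrow> nat \<Rightarrow> nat \<Rightarrow> nat \<Rightarrow> bool" where
  "power_bound X r s N \<longleftrightarrow> (\<exists>L m p. m > 0 \<and> p > 0 \<and> lie_K X = real m / real p \<and>
     r ^ L \<le> lie_M X \<and> s ^ m \<le> N ^ (p * (L + 1)))"

lemma power_boundI:
  assumes "s \<le> B ^ (L + 1)" "B ^ m \<le> N ^ p" "m > 0" "p > 0" "lie_K X = real m / real p"
    and "r ^ L \<le> lie_M X"
  shows "power_bound X r s N"
proof -
  have "s ^ m \<le> (B ^ (L + 1)) ^ m" using assms by (intro power_mono) auto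
  also have "\<dots> = (B ^ m) ^ (L + 1)" by (simp only: mult.commute flip: power_mult)
  also have "\<dots> \<le> (N ^ p) ^ (L + 1)" using assms by (intro power_mono) auto
  finally have "s ^ m \<le> N ^ (p * (L + 1))" by (simp only: power_mult)
  then show ?thesis using assms unfolding power_bound_def by blast
qed

lemma prime_power_dvd_strip:
  assumes "prime r" "\<not> r dvd q" "int r ^ v dvd int q ^ a * P"
  shows "int r ^ v dvd P"
proof -
  have "coprime (int r ^ v) (int q ^ a)"
    using prime_imp_coprime[OF assms(1,2)] by simp
  then show ?thesis using assms(3) by (simp add: coprime_dvd_mult_right_iff)
qed

text \<open>
  How the denominator \<open>d\<close> is absorbed: a surplus power \<open>q ^ f\<close> in the lower bound for the
  numerator pays for it.
\<close>

lemma order_lower_bound: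
  fixes q N e f c :: nat
  assumes "int q ^ (e + f) \<le> int c * (d * int N)" and "int c * d \<le> int q ^ f" and "q \<ge> 1"
  shows "q ^ e \<le> N"
proof -
  have "int q ^ e * int q ^ f \<le> (int c * d) * int N" using assms(1) by (simp add: power_add mult_ac)
  also have "\<dots> \<le> int q ^ f * int N" using assms by (intro mult_right_mono) auto
  finally have "int q ^ e \<le> int N" using assms by (simp add: mult.commute)
  then show ?thesis by (simp flip: of_nat_power)
qed

section \<open>Classical families\<close>

lemma power_bound_LieA:
  assumes q: "q \<ge> 2" and r: "prime r" "\<not> r dvd q" and adm: "lie_admissible (LieA n) q"
    and N: "lie_denominator (LieA n) (int q) * int N = lie_numerator (LieA n) (int q)"
    and dvd: "int r ^ v dvd lie_numerator (LieA n) (int q)"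
  shows "power_bound (LieA n) r (r ^ v) N"
proof -
  let ?d = "gcd (int n + 1) (int q - 1)"
  have n: "n \<ge> 1" using adm by simp
  have "int r ^ v dvd (\<Prod>i=2..n+1. int q ^ i - 1)"
    by (rule prime_power_dvd_strip[OF r, of v "n * (n + 1) div 2"]) (use dvd in simp)
  also have "\<dots> dvd (\<Prod>i=1..n+1. int q ^ i - 1)" by (intro prod_dvd_prod_subset) auto
  finally have dvd': "int r ^ v dvd (\<Prod>i=1..n+1. int q ^ i - 1)" .
  have "\<exists>L. r ^ L \<le> n + 1 \<and> r ^ v \<le> (q ^ (n + 1)) ^ (L + 1)"
    by (rule prime_power_dvd_prod_power_minus_one[OF r(1) _ _ q _ _ dvd']) (use q r in auto)
  then obtain L where L: "r ^ L \<le> n + 1" "r ^ v \<le> (q ^ (n + 1)) ^ (L + 1)" by blast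
  have exps: "n * (n + 1) div 2 + \<Sum>{2..n+1} = (n + 1) * n + n"
    by (induction n) (auto simp: algebra_simps)
  have "int q ^ ((n + 1) * n + n) = int q ^ (n * (n + 1) div 2) * int q ^ \<Sum>{2..n+1}"
    unfolding exps[symmetric] by (rule power_add)
  also have "\<dots> \<le> int q ^ (n * (n + 1) div 2) * (2 * (\<Prod>i=2..n+1. int q ^ i - 1))"
    using q by (intro mult_left_mono prod_power_minus_one_lower) auto
  also have "\<dots> = int 2 * (?d * int N)" using N by simp
  finally have lower: "int q ^ ((n + 1) * n + n) \<le> int 2 * (?d * int N)" .
  have "2 * ?d \<le> int q ^ n"
  proof (cases "n = 1")
    case True
    then have "?d \<le> 2" using gcd_le1_int[of 2 "int q - 1"] by simp
    moreover have "int q ^ n \<ge> 4" using adm q True by auto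
    ultimately show ?thesis by linarith
  next
    case False
    have "?d \<le> int q - 1" using q by (intro gcd_le2_int) simp
    moreover have "2 * int q \<le> int q * int q" using q by (intro mult_right_mono) auto
    moreover have "int q * int q \<le> int q ^ n"
      using False n q power_increasing[of 2 n "int q"] by (simp add: power2_eq_square)
    ultimately show ?thesis by linarith
  qed
  then have "q ^ ((n + 1) * n) \<le> N" using order_lower_bound[OF lower] q by simp
  then have "(q ^ (n + 1)) ^ n \<le> N ^ 1" unfolding power_mult by simp
  then show ?thesis by (rule power_boundI[OF L(2)]) (use L n in auto)
qed

lemma power_bound_Tw2A:
  assumes q: "q \<ge> 2" and r: "prime r" "\<not> r dvd q" and adm: "lie_admissible (Tw2A n) q"
    and N: "lie_denominator (Tw2A n) (int q) * int N = lie_numerator (Tw2A n) (int q)"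
    and dvd: "int r ^ v dvd lie_numerator (Tw2A n) (int q)"
  shows "power_bound (Tw2A n) r (r ^ v) N"
proof -
  let ?d = "gcd (int n + 1) (int q + 1)"
  have n: "n \<ge> 2" using adm by simp
  have "int r ^ v dvd (\<Prod>i=2..n+1. int q ^ i - (- 1) ^ i)"
    by (rule prime_power_dvd_strip[OF r, of v "n * (n + 1) div 2"]) (use dvd in simp)
  also have "\<dots> dvd (\<Prod>i=2..n+1. (- int q) ^ i - 1)"
  proof (intro prod_dvd_prod)
    fix i
    have "(- int q) ^ i - 1 = (- 1) ^ i * (int q ^ i - (- 1) ^ i)"
      by (cases "even i") auto
    then show "int q ^ i - (- 1) ^ i dvd (- int q) ^ i - 1" by simp
  qed
  also have "\<dots> dvd (\<Prod>i=1..n+1. (- int q) ^ i - 1)" by (intro prod_dvd_prod_subset) auto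
  finally have dvd': "int r ^ v dvd (\<Prod>i=1..n+1. (- int q) ^ i - 1)" .
  have bound: "\<bar>(- int q) ^ k - 1\<bar> \<le> int (q\<^sup>2) ^ k" if "k > 0" for k
  proof -
    have "int q \<le> int q ^ k" using q that by (intro self_le_power) auto
    then have "2 \<le> int q ^ k" using q by linarith
    then have "int q ^ k + 1 \<le> int q ^ k * int q ^ k"
      using mult_right_mono[of 2 "int q ^ k" "int q ^ k"] by simp
    moreover have "\<bar>(- int q) ^ k - 1\<bar> \<le> int q ^ k + 1"
      using \<open>2 \<le> int q ^ k\<close> by (cases "even k") (simp_all add: abs_if)
    ultimately show ?thesis by (simp add: power_mult[symmetric] mult_2 power_add)
  qed
  have q2: "q\<^sup>2 \<ge> 2" using q power_increasing[of 1 2 q] by simp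
  have "\<exists>L. r ^ L \<le> n + 1 \<and> r ^ v \<le> ((q\<^sup>2) ^ (n + 1)) ^ (L + 1)"
    by (rule prime_power_dvd_prod_power_minus_one[OF r(1) _ _ q2 bound _ dvd']) (use q r in auto)
  then obtain L where L: "r ^ L \<le> n + 1" "r ^ v \<le> ((q\<^sup>2) ^ (n + 1)) ^ (L + 1)" by blast
  have exps: "n * (n + 1) div 2 + \<Sum>{2..n+1} = (n + 1) * n + n"
    by (induction n) (auto simp: algebra_simps)
  have "int q ^ ((n + 1) * n + n) = int q ^ (n * (n + 1) div 2) * int q ^ \<Sum>{2..n+1}"
    unfolding exps[symmetric] by (rule power_add)
  also have "\<dots> \<le> int q ^ (n * (n + 1) div 2) * (2 * (\<Prod>i=2..n+1. int q ^ i - 1))"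
    using q by (intro mult_left_mono prod_power_minus_one_lower) auto
  also have "\<dots> \<le> int q ^ (n * (n + 1) div 2) * (2 * (\<Prod>i=2..n+1. int q ^ i - (- 1) ^ i))"
    using q by (intro mult_left_mono prod_mono) (auto simp: minus_one_power_iff)
  also have "\<dots> = int 2 * (?d * int N)" using N by simp
  finally have lower: "int q ^ ((n + 1) * n + n) \<le> int 2 * (?d * int N)" .
  have "2 * ?d \<le> int q ^ n"
  proof -
    have d: "?d \<le> int q + 1" using q by (intro gcd_le2_int) simp
    show ?thesis
    proof (cases "n = 2")
      case True
      then have "q \<ge> 3" using adm q by auto
      then have "3 * int q \<le> int q * int q" "3 \<le> int q" by (auto intro: mult_right_mono)
      moreover have "int q ^ n = int q * int q" using True by (simp add: power2_eq_square)
      ultimately show ?thesis using d by linarith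
    next
      case False
      have "2 * 2 \<le> int q * int q" using q by (intro mult_mono) auto
      then have "int q * 4 \<le> int q * (int q * int q)" by (intro mult_left_mono) auto
      moreover have "int q * (int q * int q) \<le> int q ^ n"
        using False n q power_increasing[of 3 n "int q"] by (simp add: power3_eq_cube)
      moreover have "2 \<le> int q" using q by simp
      ultimately show ?thesis using d by linarith
    qed
  qed
  then have "q ^ ((n + 1) * n) \<le> N" using order_lower_bound[OF lower] q by simp
  then have "(q ^ ((n + 1) * n)) ^ 2 \<le> N ^ 2" by (intro power_mono) auto
  then have "((q\<^sup>2) ^ (n + 1)) ^ n \<le> N ^ 2" by (simp only: mult_ac flip: power_mult)
  then show ?thesis by (rule power_boundI[OF L(2)]) (use L n in auto)
qed

text \<open>The product common to the symplectic and orthogonal families.\<close>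

lemma prime_power_dvd_even_product:
  assumes q: "q \<ge> 2" and r: "prime r" "\<not> r dvd q" and n: "n \<ge> 1"
    and dvd: "int r ^ v dvd (\<Prod>i=1..n. int q ^ (2 * i) - 1)"
  shows "\<exists>L. r ^ L \<le> 2 * n \<and> r ^ v \<le> (q ^ (2 * n)) ^ (L + 1)"
proof -
  have "(\<Prod>i=1..n. int q ^ (2 * i) - 1) = (\<Prod>i\<in>(*) 2 ` {1..n}. int q ^ i - 1)"
    by (subst prod.reindex) (auto simp: inj_on_def)
  also have "\<dots> dvd (\<Prod>i=1..2*n. int q ^ i - 1)" by (intro prod_dvd_prod_subset) auto
  finally have "int r ^ v dvd (\<Prod>i=1..2*n. int q ^ i - 1)" using dvd dvd_trans by blast
  then show ?thesis
    by (intro prime_power_dvd_prod_power_minus_one[OF r(1) _ _ q, of "int q"]) (use q r n in auto)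
qed

lemma even_product_lower:
  assumes q: "q \<ge> 2"
  shows "int q ^ (n * (n + 1)) \<le> 2 * (\<Prod>i=1..n. int q ^ (2 * i) - 1)"
proof -
  have "\<Sum>((*) 2 ` {1..n}) = (\<Sum>i=1..n. 2 * i)" by (subst sum.reindex) (auto simp: inj_on_def)
  also have "\<dots> = n * (n + 1)" by (induction n) auto
  finally have "int q ^ (n * (n + 1)) = int q ^ \<Sum>((*) 2 ` {1..n})" by simp
  also have "\<dots> \<le> 2 * (\<Prod>i\<in>(*) 2 ` {1..n}. int q ^ i - 1)"
    using q by (intro prod_power_minus_one_lower) auto
  also have "(\<Prod>i\<in>(*) 2 ` {1..n}. int q ^ i - 1) = (\<Prod>i=1..n. int q ^ (2 * i) - 1)"
    by (subst prod.reindex) (auto simp: inj_on_def)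
  finally show ?thesis .
qed

lemma power_bound_LieB_LieC:
  assumes q: "q \<ge> 2" and r: "prime r" "\<not> r dvd q" and X: "X = LieB n \<or> X = LieC n"
    and n: "n \<ge> 2"
    and N: "lie_denominator X (int q) * int N = lie_numerator X (int q)"
    and dvd: "int r ^ v dvd lie_numerator X (int q)"
  shows "power_bound X r (r ^ v) N"
proof -
  let ?d = "gcd 2 (int q - 1)"
  have "int r ^ v dvd (\<Prod>i=1..n. int q ^ (2 * i) - 1)"
    by (rule prime_power_dvd_strip[OF r, of v "n\<^sup>2"]) (use dvd X in auto)
  then obtain L where L: "r ^ L \<le> 2 * n" "r ^ v \<le> (q ^ (2 * n)) ^ (L + 1)"
    using prime_power_dvd_even_product[OF q r, of n v] n by auto
  have exps: "2 * n * n + n = n\<^sup>2 + n * (n + 1)" by (simp add: power2_eq_square)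
  have "int q ^ (2 * n * n + n) = int q ^ n\<^sup>2 * int q ^ (n * (n + 1))"
    unfolding exps by (rule power_add)
  also have "\<dots> \<le> int q ^ n\<^sup>2 * (2 * (\<Prod>i=1..n. int q ^ (2 * i) - 1))"
    by (intro mult_left_mono even_product_lower q) auto
  also have "\<dots> = int 2 * (?d * int N)" using N X by auto
  finally have lower: "int q ^ (2 * n * n + n) \<le> int 2 * (?d * int N)" .
  have "?d \<le> 2" by (intro gcd_le1_int) simp
  moreover have "int q ^ n \<ge> 2 ^ n" using q by (intro power_mono) auto
  moreover have "(2::int) ^ n \<ge> 4" using n power_increasing[of 2 n "2::int"] by simp
  ultimately have "2 * ?d \<le> int q ^ n" by linarith
  then have "q ^ (2 * n * n) \<le> N" using order_lower_bound[OF lower] q by simp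
  then have "(q ^ (2 * n)) ^ n \<le> N ^ 1" unfolding power_mult by simp
  then show ?thesis by (rule power_boundI[OF L(2)]) (use L n X in auto)
qed

text \<open>
  The factor \<open>q ^ n + s\<close> is simply estimated by \<open>q ^ (n + 1)\<close>, and the remaining product is the one
  of rank \<open>n - 1\<close> above. This is affordable because \<open>K\<close> is only \<open>n / 2\<close>.
\<close>

lemma power_bound_LieD_Tw2D:
  fixes s :: int
  assumes q: "q \<ge> 2" and r: "prime r" "\<not> r dvd q" and n: "n \<ge> 4"
    and X: "X = LieD n \<and> s = -1 \<or> X = Tw2D n \<and> s = 1"
    and N: "lie_denominator X (int q) * int N = lie_numerator X (int q)"
    and dvd: "int r ^ v dvd lie_numerator X (int q)"
  shows "power_bound X r (r ^ v) N"
proof -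
  let ?d = "gcd 4 (int q ^ n + s)"
  let ?P = "\<Prod>i=1..n-1. int q ^ (2 * i) - 1"
  have pe: "prime_elem (int r)" using r by simp
  have q1: "int q ^ k \<ge> 1" for k using q by simp
  have qn: "int q ^ n \<ge> 2 * int q ^ (n - 1)"
    using q n by (cases n) (auto intro: mult_right_mono)
  have s: "int q ^ (n - 1) \<le> int q ^ n + s" "int q ^ n + s \<le> int q ^ (n + 1)"
  proof -
    show "int q ^ (n - 1) \<le> int q ^ n + s" using X qn q1[of "n - 1"] by auto
    have "int q ^ (n + 1) \<ge> 2 * int q ^ n" using q by (auto intro: mult_right_mono)
    then show "int q ^ n + s \<le> int q ^ (n + 1)" using X q1[of n] by auto
  qed
  have pos: "int q ^ n + s > 0" using s(1) q1[of "n - 1"] by linarith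
  have num: "lie_numerator X (int q) = int q ^ (n * (n - 1)) * ((int q ^ n + s) * ?P)"
    using X by auto
  have "int r ^ v dvd (int q ^ n + s) * ?P"
    by (rule prime_power_dvd_strip[OF r, of v "n * (n - 1)"]) (use dvd num in simp)
  moreover define a where "a = multiplicity (int r) (int q ^ n + s)"
  moreover define b where "b = multiplicity (int r) ?P"
  moreover have nz: "int q ^ n + s \<noteq> 0" "?P \<noteq> 0"
    using pos q power_minus_one_neq_0[of "int q"] by auto
  ultimately have "v \<le> a + b"
    using r(1) power_dvd_iff_le_multiplicity[of "(int q ^ n + s) * ?P" "int r" v]
      prime_elem_multiplicity_mult_distrib[OF pe nz] prime_gt_1_nat[OF r(1)] by simp
  have "int r ^ a \<le> int q ^ n + s"
    unfolding a_def using pos by (intro zdvd_imp_le multiplicity_dvd) auto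
  then have "int (r ^ a) \<le> int (q ^ (n + 1))" using s(2) by simp
  then have ra: "r ^ a \<le> q ^ (n + 1)" by (simp only: of_nat_le_iff)
  have b: "int r ^ b dvd ?P" unfolding b_def by (rule multiplicity_dvd)
  have "n - 1 \<ge> 1" using n by simp
  then obtain L where L: "r ^ L \<le> 2 * (n - 1)" "r ^ b \<le> (q ^ (2 * (n - 1))) ^ (L + 1)"
    using prime_power_dvd_even_product[OF q r _ b] by blast
  have "r ^ v \<le> r ^ a * r ^ b"
    using \<open>v \<le> a + b\<close> prime_gt_0_nat[OF r(1)] by (simp add: power_increasing flip: power_add)
  also have "\<dots> \<le> (q ^ (n + 1)) ^ (L + 1) * (q ^ (2 * (n - 1))) ^ (L + 1)"
  proof (intro mult_mono L)
    have "q ^ (n + 1) \<le> (q ^ (n + 1)) ^ (L + 1)" using q by (intro self_le_power) auto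
    then show "r ^ a \<le> (q ^ (n + 1)) ^ (L + 1)" by (rule le_trans[OF ra])
  qed auto
  also have "\<dots> = (q ^ (3 * n - 1)) ^ (L + 1)"
  proof -
    have "n + 1 + 2 * (n - 1) = 3 * n - 1" using n by simp
    then show ?thesis by (metis power_add power_mult_distrib)
  qed
  finally have rv: "r ^ v \<le> (q ^ (3 * n - 1)) ^ (L + 1)" .
  have exps: "n * (n - 1) + (n - 1 + (n - 1) * n) = (n - 1) * (2 * n + 1)"
    by (cases n) (auto simp: algebra_simps)
  have "int q ^ ((n - 1) * (2 * n + 1)) = int q ^ (n * (n - 1)) * (int q ^ (n - 1) * int q ^ ((n - 1) * n))"
    unfolding exps[symmetric] by (simp only: power_add)
  also have "\<dots> \<le> int q ^ (n * (n - 1)) * ((int q ^ n + s) * (2 * ?P))"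
    using even_product_lower[OF q, of "n - 1"] s(1) pos n
    by (intro mult_left_mono mult_mono) auto
  also have "\<dots> = 2 * (?d * int N)" using N X num by auto
  also have "\<dots> \<le> 2 * (4 * int N)" by (intro mult_left_mono mult_right_mono gcd_le1_int) auto
  finally have "int (q ^ ((n - 1) * (2 * n + 1))) \<le> int (8 * N)" by simp
  then have lower: "q ^ ((n - 1) * (2 * n + 1)) \<le> 8 * N" by (simp only: of_nat_le_iff)
  have "(q ^ (3 * n - 1)) ^ n \<le> N ^ 2"
  proof -
    have "(3 * n - 1) * n + 6 \<le> (n - 1) * (2 * n + 1) * 2"
    proof -
      obtain k where "n = k + 4" using n le_iff_add[of 4 n] by auto
      then show ?thesis by (simp add: algebra_simps)
    qed
    then have "q ^ ((3 * n - 1) * n + 6) \<le> q ^ ((n - 1) * (2 * n + 1) * 2)"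
      using q by (intro power_increasing) auto
    also have "\<dots> = (q ^ ((n - 1) * (2 * n + 1))) ^ 2" by (rule power_mult)
    also have "\<dots> \<le> (8 * N) ^ 2" using lower by (intro power_mono) auto
    finally have "(q ^ (3 * n - 1)) ^ n * q ^ 6 \<le> 64 * N ^ 2"
      by (simp add: power_add power_mult power_mult_distrib)
    moreover have "(2::nat) ^ 6 \<le> q ^ 6" using q by (intro power_mono) auto
    then have "(q ^ (3 * n - 1)) ^ n * 64 \<le> (q ^ (3 * n - 1)) ^ n * q ^ 6"
      by (intro mult_left_mono) auto
    ultimately show ?thesis by linarith
  qed
  moreover have "r ^ L \<le> lie_M X" using X L by auto
  ultimately show ?thesis using rv n X
    by (intro power_boundI[of _ "q ^ (3 * n - 1)" L n N 2]) auto
qed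

section \<open>Suzuki groups and small Ree groups\<close>

lemma prime_power_dvd_mult_cases:
  fixes a b :: int
  assumes r: "prime r" and dvd: "int r ^ v dvd a * b" and "\<not> (int r dvd a \<and> int r dvd b)"
  shows "int r ^ v dvd a \<or> int r ^ v dvd b"
proof -
  have "coprime (int r ^ v) x" if "\<not> int r dvd x" for x
    using prime_imp_coprime[of "int r" x] r that by simp
  then show ?thesis using assms coprime_dvd_mult_left_iff coprime_dvd_mult_right_iff by metis
qed

lemma power_bound_Tw2B2:
  assumes r: "prime r" "\<not> r dvd q" and adm: "lie_admissible Tw2B2 q"
    and N: "lie_denominator Tw2B2 (int q) * int N = lie_numerator Tw2B2 (int q)"
    and dvd: "int r ^ v dvd lie_numerator Tw2B2 (int q)"
  shows "power_bound Tw2B2 r (r ^ v) N"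
proof -
  obtain m where m: "m \<ge> 1" "q = 2 ^ (2 * m + 1)" using adm by auto
  then have q: "even q" "q \<ge> 2" using power_increasing[of 1 "2 * m + 1" "2::nat"] by auto
  then have "r \<noteq> 2" using r by auto
  have "int r ^ v dvd (int q ^ 2 + 1) * (int q - 1)"
    by (rule prime_power_dvd_strip[OF r, of v 2]) (use dvd in \<open>simp add: mult_ac\<close>)
  moreover have "\<not> (int r dvd int q ^ 2 + 1 \<and> int r dvd int q - 1)"
  proof
    assume "int r dvd int q ^ 2 + 1 \<and> int r dvd int q - 1"
    then have "int r dvd (int q ^ 2 + 1) - (int q - 1) * (int q + 1)" by (intro dvd_diff[OF _ dvd_mult2]) auto
    also have "(int q ^ 2 + 1) - (int q - 1) * (int q + 1) = int 2"
      by (simp add: algebra_simps power2_eq_square)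
    finally have "r dvd 2" by (simp only: of_nat_dvd_iff)
    then show False using primes_dvd_imp_eq[OF r(1) two_is_prime_nat] \<open>r \<noteq> 2\<close> by simp
  qed
  ultimately have "int r ^ v dvd int q ^ 2 + 1 \<or> int r ^ v dvd int q - 1"
    by (rule prime_power_dvd_mult_cases[OF r(1)])
  then have "int r ^ v \<le> int q ^ 2 + 1 \<or> int r ^ v \<le> int q - 1"
    using q by (auto dest!: zdvd_imp_le)
  moreover have "int q \<le> int q ^ 2" using q by (intro self_le_power) auto
  ultimately have "int r ^ v \<le> int q ^ 2 + 1" by linarith
  then have "int (r ^ v) \<le> int (q ^ 2 + 1)" by simp
  then have rv: "r ^ v \<le> (q ^ 2 + 1) ^ (0 + 1)" by (simp only: of_nat_le_iff) simp
  have "q \<ge> 8" using m power_increasing[of 3 "2 * m + 1" "2::nat"] by simp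
  then have "int q ^ 2 * 7 \<le> int q ^ 2 * (int q - 1)" by (intro mult_left_mono) auto
  moreover have "int q ^ 2 \<ge> 1" using q by simp
  ultimately have "int q ^ 2 + 1 \<le> int q ^ 2 * (int q - 1)" by linarith
  then have "(int q ^ 2 + 1) * (int q ^ 2 + 1) \<le> (int q ^ 2 + 1) * (int q ^ 2 * (int q - 1))"
    by (intro mult_left_mono) auto
  also have "\<dots> = int N" using N by (simp add: mult_ac)
  finally have "int ((q ^ 2 + 1) ^ 2) \<le> int (N ^ 1)" by (simp add: power2_eq_square algebra_simps)
  then have "(q ^ 2 + 1) ^ 2 \<le> N ^ 1" by (simp only: of_nat_le_iff)
  then show ?thesis by (rule power_boundI[OF rv]) auto
qed

lemma power_bound_Tw2G2:
  assumes r: "prime r" "\<not> r dvd q" and adm: "lie_admissible Tw2G2 q"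
    and N: "lie_denominator Tw2G2 (int q) * int N = lie_numerator Tw2G2 (int q)"
    and dvd: "int r ^ v dvd lie_numerator Tw2G2 (int q)"
  shows "power_bound Tw2G2 r (r ^ v) N"
proof -
  obtain m where m: "m \<ge> 1" "q = 3 ^ (2 * m + 1)" using adm by auto
  then have q: "3 dvd q" "odd q" "q \<ge> 3" using power_increasing[of 1 "2 * m + 1" "3::nat"] by auto
  then have "r \<noteq> 3" using r by auto
  define B where "B = q ^ 2 - q + 1"
  have "q \<le> q ^ 2" using q by (intro self_le_power) auto
  then have B: "int B = int q ^ 2 - int q + 1" by (simp add: B_def of_nat_diff)
  have "int q * 3 \<le> int q * int q" using q by (intro mult_left_mono) auto
  then have qB: "int q + 1 \<le> int B" using q unfolding B power2_eq_square by linarith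
  have cube: "int q ^ 3 + 1 = int B * (int q + 1)" unfolding B by algebra
  have dvd': "int r ^ v dvd int B * ((int q + 1) * (int q - 1))"
    by (rule prime_power_dvd_strip[OF r, of v 3]) (use dvd cube in \<open>simp add: mult_ac\<close>)
  have rv: "\<exists>L. r ^ v \<le> B ^ (L + 1) \<and> r ^ L \<le> 6"
  proof (cases "r = 2")
    case True
    have "odd (int B)" unfolding B using q(2) by simp
    then have "int r ^ v dvd (int q + 1) * (int q - 1)"
    proof -
      have "coprime (int r ^ v) (int B)" using \<open>odd (int B)\<close> True by simp
      then show ?thesis using dvd' by (simp add: coprime_dvd_mult_right_iff)
    qed
    then have "int r ^ v \<le> (int q + 1) * (int q - 1)" using q by (intro zdvd_imp_le) auto
    also have "\<dots> \<le> int B * int B" using qB q by (intro mult_mono) auto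
    also have "\<dots> \<le> int B * int B * int B" using qB q mult_left_mono[of 1 "int B" "int B * int B"] by simp
    finally have "int (r ^ v) \<le> int (B ^ (2 + 1))" by (simp add: mult_ac numeral_2_eq_2)
    then have "r ^ v \<le> B ^ (2 + 1)" by (simp only: of_nat_le_iff)
    moreover have "r ^ 2 \<le> 6" using True by simp
    ultimately show ?thesis by blast
  next
    case False
    have "\<not> (int r dvd int B \<and> int r dvd (int q + 1) * (int q - 1))"
    proof
      assume *: "int r dvd int B \<and> int r dvd (int q + 1) * (int q - 1)"
      then consider "int r dvd int q + 1" | "int r dvd int q - 1"
        using r(1) by (auto simp: prime_dvd_mult_iff)
      then show False
      proof cases
        case 1
        then have "int r dvd int B - (int q + 1) * (int q - 2)" using * by (intro dvd_diff[OF _ dvd_mult2]) auto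
        also have "int B - (int q + 1) * (int q - 2) = int 3" unfolding B by (simp add: algebra_simps power2_eq_square)
        finally have "r dvd 3" by (simp only: of_nat_dvd_iff)
        then show False using primes_dvd_imp_eq[OF r(1), of 3] \<open>r \<noteq> 3\<close> by simp
      next
        case 2
        then have "int r dvd int B - (int q - 1) * int q" using * by (intro dvd_diff[OF _ dvd_mult2]) auto
        also have "int B - (int q - 1) * int q = 1" unfolding B by (simp add: algebra_simps power2_eq_square)
        finally show False using r(1) by auto
      qed
    qed
    moreover have "\<not> (int r dvd int q + 1 \<and> int r dvd int q - 1)"
    proof
      assume "int r dvd int q + 1 \<and> int r dvd int q - 1"
      then have "int r dvd (int q + 1) - (int q - 1)" using dvd_diff by blast
      also have "(int q + 1) - (int q - 1) = int 2" by simp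
      finally have "r dvd 2" by (simp only: of_nat_dvd_iff)
      then show False using primes_dvd_imp_eq[OF r(1) two_is_prime_nat] False by simp
    qed
    ultimately have "int r ^ v dvd int B \<or> int r ^ v dvd int q + 1 \<or> int r ^ v dvd int q - 1"
      using prime_power_dvd_mult_cases[OF r(1)] dvd' by blast
    then have "int r ^ v \<le> int B \<or> int r ^ v \<le> int q + 1 \<or> int r ^ v \<le> int q - 1"
      using q qB by (auto dest!: zdvd_imp_le)
    then have "int r ^ v \<le> int B" using qB by linarith
    then have "int (r ^ v) \<le> int (B ^ (0 + 1))" by simp
    then have "r ^ v \<le> B ^ (0 + 1)" by (simp only: of_nat_le_iff)
    then show ?thesis by (intro exI[of _ 0]) simp
  qed
  then obtain L where L: "r ^ v \<le> B ^ (L + 1)" "r ^ L \<le> 6" by blast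
  \<comment> \<open>\<open>N = q\<^sup>3 B (q + 1) (q - 1)\<close>, so \<open>B ^ 7 \<le> N\<^sup>2\<close> amounts to
    \<open>B ^ 5 \<le> q ^ 6 (q\<^sup>2 - 1)\<^sup>2\<close>.\<close>
  have "int B \<le> int q ^ 2" "int B \<le> (int q + 1) * (int q - 1)"
    unfolding B using q by (simp_all add: power2_eq_square algebra_simps)
  then have "int B ^ 3 \<le> (int q ^ 2) ^ 3" "int B ^ 2 \<le> ((int q + 1) * (int q - 1)) ^ 2"
    by (intro power_mono; simp)+
  then have "int B ^ 2 * (int B ^ 3 * int B ^ 2) \<le>
      int B ^ 2 * ((int q ^ 2) ^ 3 * ((int q + 1) * (int q - 1)) ^ 2)"
    by (intro mult_left_mono mult_mono) auto
  also have "\<dots> = (int q ^ 3 * (int q ^ 3 + 1) * (int q - 1)) ^ 2" unfolding cube by algebra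
  also have "\<dots> = int N ^ 2" using N by simp
  finally have "int (B ^ 7) \<le> int (N ^ 2)" by (simp flip: power_add)
  then have "B ^ 7 \<le> N ^ 2" by (simp only: of_nat_le_iff)
  then show ?thesis by (rule power_boundI[OF L(1)]) (use L in auto)
qed

section \<open>Values of cyclotomic polynomials\<close>

text \<open>
  The value at \<open>x\<close> of the \<open>k\<close>-th cyclotomic polynomial, tabulated for those \<open>k\<close> that divide one
  of the degrees used below for the exceptional families. The value 1 for other \<open>k\<close> is arbitrary.
\<close>

definition cyclotomic_value :: "nat \<Rightarrow> int \<Rightarrow> int" where
  "cyclotomic_value k x =
     (if k = 1 then x - 1
      else if k = 2 then x + 1
      else if k = 3 then x ^ 2 + x + 1
      else if k = 4 then x ^ 2 + 1
      else if k = 5 then x ^ 4 + x ^ 3 + x ^ 2 + x + 1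
      else if k = 6 then x ^ 2 - x + 1
      else if k = 7 then x ^ 6 + x ^ 5 + x ^ 4 + x ^ 3 + x ^ 2 + x + 1
      else if k = 8 then x ^ 4 + 1
      else if k = 9 then x ^ 6 + x ^ 3 + 1
      else if k = 10 then x ^ 4 - x ^ 3 + x ^ 2 - x + 1
      else if k = 12 then x ^ 4 - x ^ 2 + 1
      else if k = 14 then x ^ 6 - x ^ 5 + x ^ 4 - x ^ 3 + x ^ 2 - x + 1
      else if k = 15 then x ^ 8 - x ^ 7 + x ^ 5 - x ^ 4 + x ^ 3 - x + 1
      else if k = 18 then x ^ 6 - x ^ 3 + 1
      else if k = 20 then x ^ 8 - x ^ 6 + x ^ 4 - x ^ 2 + 1
      else if k = 24 then x ^ 8 - x ^ 4 + 1
      else if k = 30 then x ^ 8 + x ^ 7 - x ^ 5 - x ^ 4 - x ^ 3 + x + 1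
      else 1)"

text \<open>
  The degree of the \<open>k\<close>-th cyclotomic polynomial, for the tabulated \<open>k\<close> only.
\<close>

definition cyclotomic_degree :: "nat \<Rightarrow> nat" where
  "cyclotomic_degree k =
     (if k \<in> {1, 2} then 1 else if k \<in> {3, 4, 6} then 2 else if k \<in> {5, 8, 10, 12} then 4
      else if k \<in> {7, 9, 14, 18} then 6 else 8)"

text \<open>The tabulated indices.\<close>

definition cyclotomic_indices :: "nat set" where
  "cyclotomic_indices = {1, 2, 3, 4, 5, 6, 7, 8, 9, 10, 12, 14, 15, 18, 20, 24, 30}"

text \<open>
  If \<open>k\<close> is the order of \<open>x\<close> modulo \<open>p\<close>, then \<open>p\<close> divides no factor of \<open>x ^ k - 1\<close> that already
  divides some \<open>x ^ i - 1\<close> with \<open>i < k\<close>.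
\<close>

lemma prime_power_dvd_cofactor:
  fixes x c :: int
  assumes p: "prime p" and dvd: "int p ^ a dvd x ^ k - 1"
    and min: "\<And>i. 0 < i \<Longrightarrow> i < k \<Longrightarrow> \<not> int p dvd x ^ i - 1"
    and fac: "x ^ k - 1 = c * prod_list gs"
    and gs: "\<forall>g\<in>set gs. \<exists>i. 0 < i \<and> i < k \<and> g dvd x ^ i - 1"
  shows "int p ^ a dvd c"
proof -
  have "coprime (int p) (prod_list gs)"
    using gs
  proof (induction gs)
    case (Cons g gs)
    then have "\<not> int p dvd g" using min dvd_trans by (metis list.set_intros(1))
    then have "coprime (int p) g" using p by (intro prime_imp_coprime) auto
    then show ?case using Cons by simp
  qed simp
  then show ?thesis using dvd unfolding fac by (simp add: coprime_dvd_mult_left_iff)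
qed

lemma prime_power_dvd_cyclotomic_value:
  fixes x :: int
  assumes p: "prime p" and dvd: "int p ^ a dvd x ^ k - 1"
    and min: "\<And>i. 0 < i \<Longrightarrow> i < k \<Longrightarrow> \<not> int p dvd x ^ i - 1"
    and k: "k \<in> cyclotomic_indices"
  shows "int p ^ a dvd cyclotomic_value k x"
proof -
  note cof = prime_power_dvd_cofactor[OF p dvd min]
  have whole: "\<exists>i. 0 < i \<and> i < k \<and> x ^ j - 1 dvd x ^ i - 1" if "0 < j" "j < k" for j
    using that by (intro exI[of _ j]) simp
  have part: "\<exists>i. 0 < i \<and> i < k \<and> g dvd x ^ i - 1" if "0 < j" "j < k" "x ^ j - 1 = g * h" for g h j
    using that by (intro exI[of _ j]) simp
  consider "k = 1" | "k = 2" | "k = 3" | "k = 4" | "k = 5" | "k = 6" | "k = 7" | "k = 8" | "k = 9"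
    | "k = 10" | "k = 12" | "k = 14" | "k = 15" | "k = 18" | "k = 20" | "k = 24" | "k = 30"
    using k unfolding cyclotomic_indices_def by blast
  then show ?thesis
  proof cases
    case 1 then show ?thesis using dvd by (simp add: cyclotomic_value_def)
  next
    case 2
    have "x ^ 2 - 1 = (x + 1) * (x ^ 1 - 1)"
      by algebra
    then show ?thesis
      using cof[of "x + 1" "[x ^ 1 - 1]"]
        whole[of 1] 2
      by (simp add: cyclotomic_value_def)
  next
    case 3
    have "x ^ 3 - 1 = (x ^ 2 + x + 1) * (x ^ 1 - 1)"
      by algebra
    then show ?thesis
      using cof[of "x ^ 2 + x + 1" "[x ^ 1 - 1]"]
        whole[of 1] 3
      by (simp add: cyclotomic_value_def)
  next
    case 4
    have "x ^ 4 - 1 = (x ^ 2 + 1) * (x ^ 2 - 1)"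
      by algebra
    then show ?thesis
      using cof[of "x ^ 2 + 1" "[x ^ 2 - 1]"]
        whole[of 2] 4
      by (simp add: cyclotomic_value_def)
  next
    case 5
    have "x ^ 5 - 1 = (x ^ 4 + x ^ 3 + x ^ 2 + x + 1) * (x ^ 1 - 1)"
      by algebra
    then show ?thesis
      using cof[of "x ^ 4 + x ^ 3 + x ^ 2 + x + 1" "[x ^ 1 - 1]"]
        whole[of 1] 5
      by (simp add: cyclotomic_value_def)
  next
    case 6
    have "x ^ 6 - 1 = (x ^ 2 - x + 1) * ((x ^ 3 - 1) * (x + 1))"
      by algebra
    moreover have "x ^ 2 - 1 = (x + 1) * (x - 1)"
      by algebra
    ultimately show ?thesis
      using cof[of "x ^ 2 - x + 1" "[x ^ 3 - 1, x + 1]"]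
        whole[of 3] part[of 2 "x + 1" "x - 1"] 6
      by (simp add: cyclotomic_value_def)
  next
    case 7
    have "x ^ 7 - 1 = (x ^ 6 + x ^ 5 + x ^ 4 + x ^ 3 + x ^ 2 + x + 1) * (x ^ 1 - 1)"
      by algebra
    then show ?thesis
      using cof[of "x ^ 6 + x ^ 5 + x ^ 4 + x ^ 3 + x ^ 2 + x + 1" "[x ^ 1 - 1]"]
        whole[of 1] 7
      by (simp add: cyclotomic_value_def)
  next
    case 8
    have "x ^ 8 - 1 = (x ^ 4 + 1) * (x ^ 4 - 1)"
      by algebra
    then show ?thesis
      using cof[of "x ^ 4 + 1" "[x ^ 4 - 1]"]
        whole[of 4] 8
      by (simp add: cyclotomic_value_def)
  next
    case 9
    have "x ^ 9 - 1 = (x ^ 6 + x ^ 3 + 1) * (x ^ 3 - 1)"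
      by algebra
    then show ?thesis
      using cof[of "x ^ 6 + x ^ 3 + 1" "[x ^ 3 - 1]"]
        whole[of 3] 9
      by (simp add: cyclotomic_value_def)
  next
    case 10
    have "x ^ 10 - 1 = (x ^ 4 - x ^ 3 + x ^ 2 - x + 1) * ((x ^ 5 - 1) * (x + 1))"
      by algebra
    moreover have "x ^ 2 - 1 = (x + 1) * (x - 1)"
      by algebra
    ultimately show ?thesis
      using cof[of "x ^ 4 - x ^ 3 + x ^ 2 - x + 1" "[x ^ 5 - 1, x + 1]"]
        whole[of 5] part[of 2 "x + 1" "x - 1"] 10
      by (simp add: cyclotomic_value_def)
  next
    case 11
    have "x ^ 12 - 1 = (x ^ 4 - x ^ 2 + 1) * ((x ^ 6 - 1) * (x ^ 2 + 1))"
      by algebra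
    moreover have "x ^ 4 - 1 = (x ^ 2 + 1) * (x ^ 2 - 1)"
      by algebra
    ultimately show ?thesis
      using cof[of "x ^ 4 - x ^ 2 + 1" "[x ^ 6 - 1, x ^ 2 + 1]"]
        whole[of 6] part[of 4 "x ^ 2 + 1" "x ^ 2 - 1"] 11
      by (simp add: cyclotomic_value_def)
  next
    case 12
    have "x ^ 14 - 1 = (x ^ 6 - x ^ 5 + x ^ 4 - x ^ 3 + x ^ 2 - x + 1) * ((x ^ 7 - 1) * (x + 1))"
      by algebra
    moreover have "x ^ 2 - 1 = (x + 1) * (x - 1)"
      by algebra
    ultimately show ?thesis
      using cof[of "x ^ 6 - x ^ 5 + x ^ 4 - x ^ 3 + x ^ 2 - x + 1" "[x ^ 7 - 1, x + 1]"]
        whole[of 7] part[of 2 "x + 1" "x - 1"] 12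
      by (simp add: cyclotomic_value_def)
  next
    case 13
    have "x ^ 15 - 1 = (x ^ 8 - x ^ 7 + x ^ 5 - x ^ 4 + x ^ 3 - x + 1) * ((x ^ 5 - 1) * (x ^ 2 + x + 1))"
      by algebra
    moreover have "x ^ 3 - 1 = (x ^ 2 + x + 1) * (x - 1)"
      by algebra
    ultimately show ?thesis
      using cof[of "x ^ 8 - x ^ 7 + x ^ 5 - x ^ 4 + x ^ 3 - x + 1" "[x ^ 5 - 1, x ^ 2 + x + 1]"]
        whole[of 5] part[of 3 "x ^ 2 + x + 1" "x - 1"] 13
      by (simp add: cyclotomic_value_def)
  next
    case 14
    have "x ^ 18 - 1 = (x ^ 6 - x ^ 3 + 1) * ((x ^ 9 - 1) * (x ^ 3 + 1))"
      by algebra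
    moreover have "x ^ 6 - 1 = (x ^ 3 + 1) * (x ^ 3 - 1)"
      by algebra
    ultimately show ?thesis
      using cof[of "x ^ 6 - x ^ 3 + 1" "[x ^ 9 - 1, x ^ 3 + 1]"]
        whole[of 9] part[of 6 "x ^ 3 + 1" "x ^ 3 - 1"] 14
      by (simp add: cyclotomic_value_def)
  next
    case 15
    have "x ^ 20 - 1 = (x ^ 8 - x ^ 6 + x ^ 4 - x ^ 2 + 1) * ((x ^ 10 - 1) * (x ^ 2 + 1))"
      by algebra
    moreover have "x ^ 4 - 1 = (x ^ 2 + 1) * (x ^ 2 - 1)"
      by algebra
    ultimately show ?thesis
      using cof[of "x ^ 8 - x ^ 6 + x ^ 4 - x ^ 2 + 1" "[x ^ 10 - 1, x ^ 2 + 1]"]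
        whole[of 10] part[of 4 "x ^ 2 + 1" "x ^ 2 - 1"] 15
      by (simp add: cyclotomic_value_def)
  next
    case 16
    have "x ^ 24 - 1 = (x ^ 8 - x ^ 4 + 1) * ((x ^ 12 - 1) * (x ^ 4 + 1))"
      by algebra
    moreover have "x ^ 8 - 1 = (x ^ 4 + 1) * (x ^ 4 - 1)"
      by algebra
    ultimately show ?thesis
      using cof[of "x ^ 8 - x ^ 4 + 1" "[x ^ 12 - 1, x ^ 4 + 1]"]
        whole[of 12] part[of 8 "x ^ 4 + 1" "x ^ 4 - 1"] 16
      by (simp add: cyclotomic_value_def)
  next
    case 17
    have "x ^ 30 - 1 = (x ^ 8 + x ^ 7 - x ^ 5 - x ^ 4 - x ^ 3 + x + 1) * ((x ^ 15 - 1) * ((x ^ 5 + 1) * (x ^ 2 - x + 1)))"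
      by algebra
    moreover have "x ^ 10 - 1 = (x ^ 5 + 1) * (x ^ 5 - 1)"
      by algebra
    moreover have "x ^ 6 - 1 = (x ^ 2 - x + 1) * (x ^ 4 + x ^ 3 - x - 1)"
      by algebra
    ultimately show ?thesis
      using cof[of "x ^ 8 + x ^ 7 - x ^ 5 - x ^ 4 - x ^ 3 + x + 1" "[x ^ 15 - 1, x ^ 5 + 1, x ^ 2 - x + 1]"]
        whole[of 15] part[of 10 "x ^ 5 + 1" "x ^ 5 - 1"] part[of 6 "x ^ 2 - x + 1" "x ^ 4 + x ^ 3 - x - 1"] 17
      by (simp add: cyclotomic_value_def)
  qed
qed

lemma cyclotomic_value_bounds:
  fixes q :: int
  assumes "q \<ge> 2" "k \<in> cyclotomic_indices"
  shows "0 < cyclotomic_value k q"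
    and "cyclotomic_value k q \<le> 2 * q ^ cyclotomic_degree k"
    and "q \<ge> 7 \<Longrightarrow> 6 * cyclotomic_value k q \<le> 7 * q ^ cyclotomic_degree k"
proof -
  \<comment> \<open>All three claims are linear in the powers of \<open>q\<close>, given that each power is at least
    twice (respectively seven times) the preceding one.\<close>
  have "2 * q ^ i \<le> q ^ Suc i" for i using assms by (auto intro: mult_right_mono)
  from this[of 0] this[of 1] this[of 2] this[of 3] this[of 4] this[of 5] this[of 6] this[of 7]
  have powers: "2 \<le> q" "2 * q \<le> q ^ 2" "2 * q ^ 2 \<le> q ^ 3" "2 * q ^ 3 \<le> q ^ 4" "2 * q ^ 4 \<le> q ^ 5"
    "2 * q ^ 5 \<le> q ^ 6" "2 * q ^ 6 \<le> q ^ 7" "2 * q ^ 7 \<le> q ^ 8" by (simp_all add: numeral_eq_Suc)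
  show "0 < cyclotomic_value k q"
    using assms(2) powers unfolding cyclotomic_indices_def
    by (elim insertE) (simp_all add: cyclotomic_value_def)
  show "cyclotomic_value k q \<le> 2 * q ^ cyclotomic_degree k"
    using assms(2) powers unfolding cyclotomic_indices_def
    by (elim insertE) (simp_all add: cyclotomic_value_def cyclotomic_degree_def)
  assume "q \<ge> 7"
  then have "7 * q ^ i \<le> q ^ Suc i" for i by (auto intro: mult_right_mono)
  from this[of 0] this[of 1] this[of 2] this[of 3] this[of 4] this[of 5] this[of 6] this[of 7]
  have powers: "7 \<le> q" "7 * q \<le> q ^ 2" "7 * q ^ 2 \<le> q ^ 3" "7 * q ^ 3 \<le> q ^ 4" "7 * q ^ 4 \<le> q ^ 5"
    "7 * q ^ 5 \<le> q ^ 6" "7 * q ^ 6 \<le> q ^ 7" "7 * q ^ 7 \<le> q ^ 8" by (simp_all add: numeral_eq_Suc)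
  show "6 * cyclotomic_value k q \<le> 7 * q ^ cyclotomic_degree k"
    using assms(2) powers unfolding cyclotomic_indices_def
    by (elim insertE) (simp_all add: cyclotomic_value_def cyclotomic_degree_def)
qed

section \<open>Orders that are products over a list of degrees\<close>

text \<open>
  The exponent of the \<open>k\<close>-th cyclotomic polynomial in the product of the \<open>q ^ i - 1\<close> over the list
  \<open>D\<close> of degrees.
\<close>

definition cyclotomic_exponent :: "nat list \<Rightarrow> nat \<Rightarrow> nat" where
  "cyclotomic_exponent D k = length (filter ((dvd) k) D)"

lemma odd_prime_power_dvd_degree_product:
  fixes q r v :: nat and D :: "nat list"
  assumes q: "q \<ge> 2" and r: "prime r" "\<not> r dvd q" "r \<noteq> 2" and v: "v > 0"
    and D: "\<forall>i\<in>set D. i > 0 \<and> (\<forall>k. k dvd i \<longrightarrow> k \<in> cyclotomic_indices)"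
    and dvd: "int r ^ v dvd (\<Prod>i\<leftarrow>D. int q ^ i - 1)"
  obtains k where "\<exists>i\<in>set D. k dvd i" "int r dvd cyclotomic_value k (int q)"
    "int r ^ v \<le> cyclotomic_value k (int q) ^ cyclotomic_exponent D k
       * int r ^ multiplicity r (prod_list D)"
proof -
  have pe: "prime_elem (int r)" "prime_elem r" using r by auto
  have nu: "\<not> is_unit (int r)" using prime_gt_1_nat[OF r(1)] by simp
  have nz: "int q ^ i - 1 \<noteq> 0" if "i > 0" for i using power_minus_one_neq_0[of "int q" i] q that by simp
  have "\<exists>i\<in>set D. int r dvd int q ^ i - 1"
  proof -
    have "int r dvd (\<Prod>i\<leftarrow>D. int q ^ i - 1)"
      using dvd v by (metis dvd_power dvd_trans)
    then show ?thesis
    proof (induction D)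
      case (Cons i D)
      then show ?case using pe(1) by (auto simp: prime_elem_dvd_mult_iff)
    qed (use nu in simp)
  qed
  then obtain j where j: "j \<in> set D" "int r dvd int q ^ j - 1" by blast
  obtain k where k: "k > 0" "int r dvd int q ^ k - 1"
    "\<And>i. 0 < i \<Longrightarrow> i < k \<Longrightarrow> \<not> int r dvd int q ^ i - 1"
    "\<And>i. i > 0 \<Longrightarrow> k dvd i \<Longrightarrow> multiplicity (int r) (int q ^ i - 1)
        \<le> multiplicity (int r) (int q ^ k - 1) + multiplicity r i"
    "\<And>i. \<not> k dvd i \<Longrightarrow> \<not> int r dvd int q ^ i - 1"
  proof (rule multiplicity_power_minus_one_order[of r "int q"])
    show "\<exists>i>0. int r dvd int q ^ i - 1" using j D by blast
  qed (use q r in auto)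
  define a where "a = multiplicity (int r) (int q ^ k - 1)"
  have kj: "k dvd j" using k(5) j(2) by blast
  have kc: "k \<in> cyclotomic_indices" using D j(1) kj by blast
  have "int r ^ a dvd int q ^ k - 1" unfolding a_def by (rule multiplicity_dvd)
  then have ra: "int r ^ a dvd cyclotomic_value k (int q)"
    using prime_power_dvd_cyclotomic_value[OF r(1) _ k(3) kc] by blast
  have "a \<ge> 1" unfolding a_def using k(1,2) nz nu by (intro multiplicity_geI) auto
  then have "int r dvd cyclotomic_value k (int q)" using ra by (metis dvd_power dvd_trans less_le_trans zero_less_one)
  moreover have "int r ^ v \<le> cyclotomic_value k (int q) ^ cyclotomic_exponent D k
       * int r ^ multiplicity r (prod_list D)"
  proof -
    have "multiplicity (int r) (\<Prod>i\<leftarrow>D. int q ^ i - 1)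
       \<le> a * cyclotomic_exponent D k + multiplicity r (prod_list D)
      \<and> (\<Prod>i\<leftarrow>D. int q ^ i - 1) \<noteq> 0 \<and> prod_list D \<noteq> 0"
      using D
    proof (induction D)
      case (Cons i D)
      have i: "i > 0" using Cons.prems by simp
      have "multiplicity (int r) (int q ^ i - 1)
        \<le> (if k dvd i then a else 0) + multiplicity r i"
        using k(4)[OF i] not_dvd_imp_multiplicity_0[OF k(5)[of i]] by (simp add: a_def)
      moreover have IH: "multiplicity (int r) (\<Prod>i\<leftarrow>D. int q ^ i - 1)
          \<le> a * cyclotomic_exponent D k + multiplicity r (prod_list D)"
        "(\<Prod>i\<leftarrow>D. int q ^ i - 1) \<noteq> 0" "prod_list D \<noteq> 0"
        using Cons by auto
      moreover have "i \<noteq> 0" using i by simp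
      ultimately show ?case
        using prime_elem_multiplicity_mult_distrib[OF pe(1) nz[OF i] IH(2)]
          prime_elem_multiplicity_mult_distrib[OF pe(2) \<open>i \<noteq> 0\<close> IH(3)] nz[OF i]
        by (auto simp: cyclotomic_exponent_def algebra_simps)
    qed (simp add: cyclotomic_exponent_def)
    then have "v \<le> a * cyclotomic_exponent D k + multiplicity r (prod_list D)"
      using dvd power_dvd_iff_le_multiplicity[of _ "int r" v] nu by (meson le_trans)
    then have "int r ^ v \<le> int r ^ (a * cyclotomic_exponent D k + multiplicity r (prod_list D))"
      using prime_gt_0_nat[OF r(1)] by (intro power_increasing) auto
    also have "\<dots> = (int r ^ a) ^ cyclotomic_exponent D k * int r ^ multiplicity r (prod_list D)"
      by (simp add: power_add power_mult)
    also have "\<dots> \<le> cyclotomic_value k (int q) ^ cyclotomic_exponent D k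
         * int r ^ multiplicity r (prod_list D)"
      using zdvd_imp_le[OF ra] cyclotomic_value_bounds(1)[OF _ kc, of "int q"] q
      by (intro mult_right_mono power_mono) auto
    finally show ?thesis .
  qed
  ultimately show ?thesis using that j(1) kj by blast
qed

text \<open>
  For the prime 2 the larger of the 2-parts of \<open>q - 1\<close> and \<open>q + 1\<close> takes the place of \<open>\<Phi>\<^sub>k(q)\<close>.
\<close>

lemma two_power_dvd_degree_product:
  fixes q v :: nat and D :: "nat list"
  assumes q: "q \<ge> 2" "odd q" and D: "\<forall>i\<in>set D. i > 0"
    and dvd: "2 ^ v dvd (\<Prod>i\<leftarrow>D. int q ^ i - 1)"
  shows "2 ^ v \<le> (q + 1) ^ length D * 2 ^ multiplicity 2 (prod_list D)"
proof -
  have pe: "prime_elem (2::int)" "prime_elem (2::nat)" by auto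
  have nu: "\<not> is_unit (2::int)" by simp
  have nz: "int q ^ i - 1 \<noteq> 0" if "i > 0" for i using power_minus_one_neq_0[of "int q" i] q that by simp
  obtain w where w: "2 ^ w \<le> q + 1"
    "\<And>i. i > 0 \<Longrightarrow> multiplicity 2 (int q ^ i - 1) \<le> w + multiplicity 2 i"
  proof (cases "4 dvd int q - 1")
    case True
    define w where "w = multiplicity 2 (int q - 1)"
    have "2 ^ w \<le> int q - 1" unfolding w_def using q by (intro zdvd_imp_le multiplicity_dvd) auto
    then have "2 ^ w \<le> int q + 1" by linarith
    then have "int (2 ^ w) \<le> int (q + 1)" by (simp add: add.commute)
    then have "2 ^ w \<le> q + 1" by (simp only: of_nat_le_iff)
    moreover have "multiplicity 2 (int q ^ i - 1) \<le> w + multiplicity 2 i" if "i > 0" for i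
      using multiplicity_power_minus_one_le[of 2 "int q" i] q True that
      by (auto simp: w_def)
    ultimately show ?thesis using that by blast
  next
    case False
    then have four: "4 dvd int q + 1" using q by presburger
    define w where "w = multiplicity 2 (int q + 1)"
    have "2 ^ w \<le> int q + 1" unfolding w_def by (intro zdvd_imp_le multiplicity_dvd) auto
    then have "int (2 ^ w) \<le> int (q + 1)" by (simp add: add.commute)
    then have "2 ^ w \<le> q + 1" by (simp only: of_nat_le_iff)
    moreover have "w \<ge> 1" unfolding w_def using q by (intro multiplicity_geI) auto
    then have "multiplicity 2 (int q ^ i - 1) \<le> w + multiplicity 2 i" if "i > 0" for i
      using multiplicity_2_power_minus_one[of "int q" i] q four that
      by (auto simp: w_def split: if_splits)
    ultimately show ?thesis using that by blast
  qed
  have "multiplicity 2 (\<Prod>i\<leftarrow>D. int q ^ i - 1) \<le> w * length D + multiplicity 2 (prod_list D)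
    \<and> (\<Prod>i\<leftarrow>D. int q ^ i - 1) \<noteq> 0 \<and> prod_list D \<noteq> 0"
    using D
  proof (induction D)
    case (Cons i D)
    then have i: "i > 0" by simp
    then show ?case using Cons w(2)[OF i] nz[OF i]
      by (simp add: prime_elem_multiplicity_mult_distrib pe)
  qed simp
  then have "v \<le> w * length D + multiplicity 2 (prod_list D)"
    using dvd power_dvd_iff_le_multiplicity[of _ "2::int" v] nu by (meson le_trans)
  then have "2 ^ v \<le> (2::nat) ^ (w * length D + multiplicity 2 (prod_list D))"
    by (intro power_increasing) auto
  also have "\<dots> = (2 ^ w) ^ length D * 2 ^ multiplicity 2 (prod_list D)"
    by (simp add: power_add power_mult)
  also have "\<dots> \<le> (q + 1) ^ length D * 2 ^ multiplicity 2 (prod_list D)"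
    using w by (intro mult_right_mono power_mono) auto
  finally show ?thesis .
qed

lemma multiplicity_smooth_7:
  assumes r: "prime (r::nat)" and n: "n = 2 ^ a * 3 ^ b * 5 ^ c * 7 ^ d"
  shows "multiplicity r n =
    (if r = 2 then a else if r = 3 then b else if r = 5 then c else if r = 7 then d else 0)"
proof -
  have primes: "prime (2::nat)" "prime (3::nat)" "prime (5::nat)" "prime (7::nat)" by simp_all
  have "multiplicity r (p ^ e) = (if r = p then e else 0)" if "prime p" for p e :: nat
    using that r multiplicity_distinct_prime_power[OF r that] by auto
  from this[OF primes(1)] this[OF primes(2)] this[OF primes(3)] this[OF primes(4)]
  show ?thesis unfolding n using r
    by (simp add: prime_elem_multiplicity_mult_distrib)
qed

section \<open>A criterion for the exceptional families\<close>

lemma power_le_order_power: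
  fixes s K c p q dim N :: nat
  assumes "s ^ K * c ^ p \<le> q ^ (dim * p)" and "q ^ dim \<le> c * N" and "q \<ge> 1"
  shows "s ^ K \<le> N ^ p"
proof -
  have "q ^ dim \<ge> 1" using assms(3) by (rule one_le_power)
  then have c: "c > 0" using assms(2,3) by (cases c) auto
  have "s ^ K * c ^ p \<le> (q ^ dim) ^ p" using assms(1) by (simp add: power_mult)
  also have "\<dots> \<le> (c * N) ^ p" using assms by (intro power_mono) auto
  finally show ?thesis using c by (simp add: power_mult_distrib)
qed

text \<open>
  Here \<open>q ^ dim \<le> c N\<close> bounds the order \<open>N\<close> from below, so \<open>q ^ dim / c\<close> stands in for \<open>N\<close>. The
  prime 2 is bounded with \<open>LL\<close> in place of \<open>\<lfloor>log r M\<rfloor>\<close>. For odd \<open>r \<le> M\<close> the exponent is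
  at least 2, and at least 3 if \<open>r\<^sup>2 \<le> M\<close>. The \<open>r\<close>-part of the product of the degrees then
  has to be at most \<open>cA\<close>, respectively \<open>cB\<close>: condition \<open>medium\<close> covers the factor \<open>cA\<close>, and
  condition \<open>cB\<close> says that a third copy of \<open>N ^ (1 / K)\<close> pays for the ratio \<open>cB / cA\<close>.
\<close>

lemma exceptional_power_bound:
  fixes q r v N K M dim c cA cB LL a b e f :: nat and D :: "nat list"
  assumes q: "q \<ge> 2" and r: "prime r" "\<not> r dvd q"
    and K: "lie_K X = real K" "K > 0" and M: "lie_M X = M" "M \<ge> 6" "M \<ge> 7 \<or> f = 0"
    and D: "\<forall>i\<in>set D. i > 0 \<and> (\<forall>k. k dvd i \<longrightarrow> k \<in> cyclotomic_indices)"
    and dvd: "int r ^ v dvd (\<Prod>i\<leftarrow>D. int q ^ i - 1)"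
    and lower: "q ^ dim \<le> c * N"
    and prodD: "prod_list D = 2 ^ a * 3 ^ b * 5 ^ e * 7 ^ f"
    and two: "odd q \<Longrightarrow> 2 ^ LL \<le> M \<and> c \<le> 9 \<and> K * (2 * length D + a) + 2 * (LL + 1) \<le> dim * (LL + 1)"
    and three: "3 ^ b \<le> cA \<or> 9 \<le> M \<and> 3 ^ b \<le> cB"
    and five: "5 ^ e \<le> cA \<or> 25 \<le> M \<and> 5 ^ e \<le> cB"
    and seven: "7 ^ f \<le> cA" and cA: "cA \<ge> 1"
    and cB: "cB ^ K * c \<le> cA ^ K * q ^ dim"
    and medium: "\<And>k y. \<exists>i\<in>set D. k dvd i \<Longrightarrow> cyclotomic_value k (int q) = int y \<Longrightarrow>
        (cA * y ^ cyclotomic_exponent D k) ^ K * c ^ 2 \<le> q ^ (dim * 2)"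
    and large: "\<And>k y. \<exists>i\<in>set D. k dvd i \<Longrightarrow> cyclotomic_value k (int q) = int y \<Longrightarrow>
        M < r \<Longrightarrow> r dvd y \<Longrightarrow> (y ^ cyclotomic_exponent D k) ^ K * c \<le> q ^ dim"
  shows "power_bound X r (r ^ v) N"
proof -
  have goal: "power_bound X r (r ^ v) N"
    if "r ^ L \<le> M" "(r ^ v) ^ K * c ^ (L + 1) \<le> q ^ (dim * (L + 1))" for L
  proof -
    have "(r ^ v) ^ K \<le> N ^ (1 * (L + 1))"
      using power_le_order_power[OF that(2) lower] q by simp
    then show ?thesis unfolding power_bound_def using K M that(1)
      by (intro exI[of _ L] exI[of _ K] exI[of _ 1]) auto
  qed
  have mult: "multiplicity r (prod_list D) =
      (if r = 2 then a else if r = 3 then b else if r = 5 then e else if r = 7 then f else 0)"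
    by (rule multiplicity_smooth_7[OF r(1) prodD])
  have r2: "r \<ge> 2" using prime_ge_2_nat[OF r(1)] .
  consider "v = 0" | "r = 2" | "v > 0" "r \<noteq> 2" by auto
  then show ?thesis
  proof cases
    case 1
    have "q ^ dim \<ge> 1" using q by (intro one_le_power) simp
    then have "N \<ge> 1" using lower q by (cases N) auto
    then show ?thesis unfolding power_bound_def using K M 1
      by (intro exI[of _ 0] exI[of _ K] exI[of _ 1]) auto
  next
    case 2
    then have "odd q" using r(2) by simp
    then have q3: "q \<ge> 3" using q by presburger
    have nums: "2 ^ LL \<le> M" "c \<le> 9" "K * (2 * length D + a) + 2 * (LL + 1) \<le> dim * (LL + 1)"
      using two[OF \<open>odd q\<close>] by auto
    have "2 ^ v \<le> (q + 1) ^ length D * 2 ^ a"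
      using two_power_dvd_degree_product[OF q \<open>odd q\<close>, of D v] D dvd mult 2 by simp
    also have "\<dots> \<le> (q ^ 2) ^ length D * q ^ a"
    proof (intro mult_mono power_mono)
      have "3 * q \<le> q * q" using q3 by (intro mult_right_mono) auto
      then have "q + 1 \<le> q * q" using q3 by linarith
      then show "q + 1 \<le> q ^ 2" by (simp only: power2_eq_square)
    qed (use q in auto)
    also have "\<dots> = q ^ (2 * length D + a)" by (simp add: power_add power_mult)
    finally have "(2 ^ v) ^ K \<le> (q ^ (2 * length D + a)) ^ K" by (intro power_mono) auto
    also have "\<dots> = q ^ (K * (2 * length D + a))" by (simp add: mult.commute flip: power_mult)
    finally have "(2 ^ v) ^ K * c ^ (LL + 1) \<le> q ^ (K * (2 * length D + a)) * (q ^ 2) ^ (LL + 1)"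
    proof (intro mult_mono power_mono)
      have "3 * 3 \<le> q * q" using q3 by (intro mult_mono) auto
      then show "c \<le> q ^ 2" using nums by (simp add: power2_eq_square)
    qed auto
    also have "\<dots> = q ^ (K * (2 * length D + a) + 2 * (LL + 1))" by (simp only: power_add power_mult)
    also have "\<dots> \<le> q ^ (dim * (LL + 1))" using nums q by (intro power_increasing) auto
    finally show ?thesis using goal[of LL] nums 2 by simp
  next
    case 3
    obtain k where k: "\<exists>i\<in>set D. k dvd i" "int r dvd cyclotomic_value k (int q)"
      "int r ^ v \<le> cyclotomic_value k (int q) ^ cyclotomic_exponent D k
         * int r ^ multiplicity r (prod_list D)"
      using odd_prime_power_dvd_degree_product[OF q r 3(2,1) D dvd] by blast
    have kc: "k \<in> cyclotomic_indices" using k(1) D by blast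
    obtain y where y: "cyclotomic_value k (int q) = int y"
      using cyclotomic_value_bounds(1)[OF _ kc, of "int q"] q by (metis nonneg_int_cases less_imp_le of_nat_mono of_nat_numeral)
    let ?Y = "y ^ cyclotomic_exponent D k"
    have ry: "r dvd y" using k(2) y by simp
    have "int (r ^ v) \<le> int (?Y * r ^ multiplicity r (prod_list D))" using k(3) y by simp
    then have rv: "r ^ v \<le> ?Y * r ^ multiplicity r (prod_list D)" by (simp only: of_nat_le_iff)
    show ?thesis
    proof (cases "M < r")
      case True
      have "r \<noteq> 3" "r \<noteq> 5" "r \<noteq> 7 \<or> f = 0" using True M by auto
      then have "r ^ v \<le> ?Y" using rv mult 3 by (auto split: if_splits)
      then have "(r ^ v) ^ K * c ^ (0 + 1) \<le> ?Y ^ K * c" by (simp add: power_mono)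
      also have "\<dots> \<le> q ^ (dim * (0 + 1))" using large[OF k(1) y True ry] by simp
      finally show ?thesis using goal[of 0] M by simp
    next
      case False
      have med: "(cA * ?Y) ^ K * c ^ 2 \<le> q ^ (dim * 2)" by (rule medium[OF k(1) y])
      have "r ^ multiplicity r (prod_list D) \<le> cA \<or>
        r ^ 2 \<le> M \<and> r ^ multiplicity r (prod_list D) \<le> cB"
        using three five seven cA mult 3 by auto
      then show ?thesis
      proof
        assume "r ^ multiplicity r (prod_list D) \<le> cA"
        then have "?Y * r ^ multiplicity r (prod_list D) \<le> ?Y * cA" by (rule mult_left_mono) simp
        with rv have "r ^ v \<le> ?Y * cA" by (rule le_trans)
        then have "r ^ v \<le> cA * ?Y" by (simp add: mult.commute)
        then have "(r ^ v) ^ K * c ^ 2 \<le> (cA * ?Y) ^ K * c ^ 2"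
          by (intro mult_right_mono power_mono) auto
        then have "(r ^ v) ^ K * c ^ 2 \<le> q ^ (dim * 2)" using med by (rule le_trans)
        then show ?thesis using goal[of 1, unfolded one_add_one] False by simp
      next
        assume s: "r ^ 2 \<le> M \<and> r ^ multiplicity r (prod_list D) \<le> cB"
        then have "?Y * r ^ multiplicity r (prod_list D) \<le> ?Y * cB" by (intro mult_left_mono) auto
        with rv have "r ^ v \<le> ?Y * cB" by (rule le_trans)
        then have "r ^ v \<le> cB * ?Y" by (simp add: mult.commute)
        then have "(r ^ v) ^ K * c ^ 3 \<le> (cB * ?Y) ^ K * c ^ 3"
          by (intro mult_mono power_mono) auto
        then have "cA ^ K * ((r ^ v) ^ K * c ^ 3) \<le> cA ^ K * ((cB * ?Y) ^ K * c ^ 3)"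
          by (intro mult_left_mono) auto
        also have "\<dots> = ((cA * ?Y) ^ K * c ^ 2) * (cB ^ K * c)"
          by (simp add: power_mult_distrib power2_eq_square power3_eq_cube)
        also have "\<dots> \<le> q ^ (dim * 2) * (cA ^ K * q ^ dim)" by (intro mult_mono med cB) auto
        also have "\<dots> = cA ^ K * q ^ (dim * 3)"
          by (simp add: power_mult power2_eq_square power3_eq_cube)
        finally have "(r ^ v) ^ K * c ^ 3 \<le> q ^ (dim * 3)" using cA by simp
        then show ?thesis using goal[of 2] s by (simp add: numeral_3_eq_3 numeral_2_eq_2)
      qed
    qed
  qed
qed

lemma cyclotomic_power_le:
  assumes y: "cyclotomic_value k (int q) = int y" and q: "q \<ge> 2" and k: "k \<in> cyclotomic_indices"
    and C: "(if k = 1 then 1 else if k = 2 then 3 / 2 else 2) ^ e \<le> real C"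
    and deg: "cyclotomic_degree k * e \<le> d"
  shows "y ^ e \<le> C * q ^ d"
proof -
  let ?t = "if k = 1 then 1 else if k = 2 then 3 / 2 else (2::real)"
  have "real y \<le> ?t * real q ^ cyclotomic_degree k"
  proof -
    consider "k = 1" | "k = 2" | "k \<noteq> 1" "k \<noteq> 2" by blast
    then show ?thesis
    proof cases
      case 3
      have "int y \<le> 2 * int q ^ cyclotomic_degree k"
        using cyclotomic_value_bounds(2)[OF _ k, of "int q"] q y by simp
      then have "real_of_int (int y) \<le> real_of_int (2 * int q ^ cyclotomic_degree k)"
        by (simp only: of_int_le_iff)
      then show ?thesis using 3 by simp
    qed (use y q in \<open>simp_all add: cyclotomic_value_def cyclotomic_degree_def\<close>)
  qed
  then have "real y ^ e \<le> (?t * real q ^ cyclotomic_degree k) ^ e" by (intro power_mono) auto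
  also have "\<dots> = ?t ^ e * real q ^ (cyclotomic_degree k * e)"
    by (simp only: power_mult_distrib power_mult)
  also have "\<dots> \<le> real C * real q ^ d"
    using C deg q by (intro mult_mono power_increasing) auto
  finally have "real (y ^ e) \<le> real (C * q ^ d)" by simp
  then show ?thesis by (simp only: of_nat_le_iff)
qed

text \<open>
  A sharper bound for \<open>q \<ge> 7\<close>. In the exceptional orders \<open>\<Phi>\<^sub>1\<close> and \<open>\<Phi>\<^sub>2\<close> have the largest
  exponents, so these two get better constants. The condition \<open>q \<ge> 10\<close> for \<open>\<Phi>\<^sub>2\<close> will come from a
  prime factor of \<open>q + 1\<close> above \<open>M \<ge> 10\<close>.
\<close>

lemma cyclotomic_power_le_7:
  assumes y: "cyclotomic_value k (int q) = int y" and q: "q \<ge> 7" and k: "k \<in> cyclotomic_indices"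
    and A: "k = 1 \<and> 1 \<le> A \<or> (7 / 6) ^ e \<le> A \<or> k = 2 \<and> q \<ge> 10 \<and> (11 / 10) ^ e \<le> (A :: real)"
    and deg: "cyclotomic_degree k * e \<le> d"
  shows "real y ^ e \<le> A * real q ^ d"
proof -
  have main: ?thesis if "real y \<le> t * real q ^ cyclotomic_degree k" "t ^ e \<le> A" "t > 0" for t
  proof -
    have "real y ^ e \<le> (t * real q ^ cyclotomic_degree k) ^ e" using that by (intro power_mono) auto
    also have "\<dots> = t ^ e * real q ^ (cyclotomic_degree k * e)"
      by (simp only: power_mult_distrib power_mult)
    also have "\<dots> \<le> A * real q ^ d"
      using that deg q by (intro mult_mono power_increasing) (auto intro: order_trans[of _ "t ^ e"])
    finally show ?thesis .
  qed
  from A show ?thesis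
  proof (elim disjE conjE)
    assume "k = 1" "1 \<le> A"
    then show ?thesis using y q
      by (intro main[of 1]) (simp_all add: cyclotomic_value_def cyclotomic_degree_def)
  next
    assume "(7 / 6) ^ e \<le> A"
    moreover have "6 * int y \<le> 7 * int q ^ cyclotomic_degree k"
      using cyclotomic_value_bounds(3)[OF _ k, of "int q"] q y by simp
    then have "real_of_int (6 * int y) \<le> real_of_int (7 * int q ^ cyclotomic_degree k)"
      by (simp only: of_int_le_iff)
    ultimately show ?thesis by (intro main[of "7 / 6"]) simp_all
  next
    assume "k = 2" "q \<ge> 10" "(11 / 10) ^ e \<le> A"
    then show ?thesis using y
      by (intro main[of "11 / 10"]) (simp_all add: cyclotomic_value_def cyclotomic_degree_def)
  qed
qed


text \<open>
  The criterion reduced to finitely many numerical conditions. The powers \<open>\<Phi>\<^sub>k(q) ^ e\<close> are at most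
  \<open>C q ^ d\<close> in general, and at most \<open>A q ^ d\<close> if \<open>q \<ge> 7\<close> and \<open>r > M\<close>; \<open>qmin\<close> is the
  smallest parameter considered. The values \<open>q < 7\<close> with \<open>r > M\<close> are left to condition \<open>small\<close>.
\<close>

lemma exceptional_power_bound_numeric:
  fixes q r v N K M dim c cA cB LL a b e f C d qmin :: nat and D :: "nat list" and A :: real
  assumes q: "q \<ge> 2" "qmin \<le> q" and r: "prime r" "\<not> r dvd q"
    and dvd: "int r ^ v dvd (\<Prod>i\<leftarrow>D. int q ^ i - 1)"
    and lower: "q ^ dim \<le> c * N"
    and K: "lie_K X = real K" "K > 0" and M: "lie_M X = M" "M \<ge> 6" "M \<ge> 7 \<or> f = 0"
    and D: "\<forall>i\<in>set D. i > 0 \<and> (\<forall>k. k dvd i \<longrightarrow> k \<in> cyclotomic_indices)"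
    and prodD: "prod_list D = 2 ^ a * 3 ^ b * 5 ^ e * 7 ^ f"
    and two: "odd q \<Longrightarrow> 2 ^ LL \<le> M \<and> c \<le> 9 \<and> K * (2 * length D + a) + 2 * (LL + 1) \<le> dim * (LL + 1)"
    and three: "3 ^ b \<le> cA \<or> 9 \<le> M \<and> 3 ^ b \<le> cB"
    and five: "5 ^ e \<le> cA \<or> 25 \<le> M \<and> 5 ^ e \<le> cB"
    and seven: "7 ^ f \<le> cA" and cA: "cA \<ge> 1"
    and cB: "cB ^ K * c \<le> cA ^ K * qmin ^ dim"
    and Kd: "K * d \<le> dim"
    and C: "(cA * C) ^ K * c ^ 2 \<le> qmin ^ (dim * 2 - K * d)"
    and A: "A ^ K * real c \<le> 7 ^ (dim - K * d)" "1 \<le> A"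
    and ks: "\<And>k. \<exists>i\<in>set D. k dvd i \<Longrightarrow>
       cyclotomic_degree k * cyclotomic_exponent D k \<le> d \<and>
       (if k = 1 then 1 else if k = 2 then 3 / 2 else 2) ^ cyclotomic_exponent D k \<le> real C \<and>
       (k = 1 \<or> (7 / 6) ^ cyclotomic_exponent D k \<le> A
         \<or> k = 2 \<and> 10 \<le> M \<and> (11 / 10) ^ cyclotomic_exponent D k \<le> A)"
    and small: "\<And>k. \<exists>i\<in>set D. k dvd i \<Longrightarrow> q < 7 \<Longrightarrow> M < r \<Longrightarrow>
       r dvd nat (cyclotomic_value k (int q)) \<Longrightarrow> r \<le> nat (cyclotomic_value k (int q)) \<Longrightarrow>
       (nat (cyclotomic_value k (int q)) ^ cyclotomic_exponent D k) ^ K * c \<le> q ^ dim"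
  shows "power_bound X r (r ^ v) N"
proof (rule exceptional_power_bound[OF q(1) r K M D dvd lower prodD two three five seven cA])
  have mono: "qmin ^ j \<le> q ^ j" for j using q by (intro power_mono) auto
  show "cB ^ K * c \<le> cA ^ K * q ^ dim"
    by (rule order_trans[OF cB]) (intro mult_left_mono mono, simp)
  fix k y
  assume k: "\<exists>i\<in>set D. k dvd i" and y: "cyclotomic_value k (int q) = int y"
  have kc: "k \<in> cyclotomic_indices" using k D by blast
  let ?e = "cyclotomic_exponent D k"
  have "y ^ ?e \<le> C * q ^ d"
    using ks[OF k] by (intro cyclotomic_power_le[OF y q(1) kc]) auto
  then have "(cA * y ^ ?e) ^ K * c ^ 2 \<le> (cA * (C * q ^ d)) ^ K * c ^ 2"
    by (intro mult_right_mono power_mono mult_left_mono) auto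
  also have "\<dots> = ((cA * C) ^ K * c ^ 2) * q ^ (K * d)"
    by (simp add: power_mult_distrib mult.commute[of K] power_mult)
  also have "\<dots> \<le> q ^ (dim * 2 - K * d) * q ^ (K * d)"
    by (intro mult_right_mono order_trans[OF C mono]) auto
  also have "\<dots> = q ^ (dim * 2)" using Kd by (simp flip: power_add)
  finally show "(cA * y ^ ?e) ^ K * c ^ 2 \<le> q ^ (dim * 2)" .
  assume Mr: "M < r" and ry: "r dvd y"
  have "y > 0" using cyclotomic_value_bounds(1)[OF _ kc, of "int q"] q y by simp
  then have "r \<le> y" using ry by (intro dvd_imp_le)
  show "(y ^ ?e) ^ K * c \<le> q ^ dim"
  proof (cases "q < 7")
    case True
    then show ?thesis using small[OF k True Mr] ry y \<open>r \<le> y\<close> by simp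
  next
    case False
    have "k = 2 \<Longrightarrow> M \<le> q" using Mr \<open>r \<le> y\<close> y by (simp add: cyclotomic_value_def)
    then have "real y ^ ?e \<le> A * real q ^ d"
      using ks[OF k] False A(2) by (intro cyclotomic_power_le_7[OF y _ kc]) auto
    then have "(real y ^ ?e) ^ K * real c \<le> (A * real q ^ d) ^ K * real c"
      by (intro mult_right_mono power_mono) auto
    also have "\<dots> = (A ^ K * real c) * real q ^ (K * d)"
      by (simp add: power_mult_distrib mult.commute[of K] power_mult)
    also have "\<dots> \<le> real q ^ (dim - K * d) * real q ^ (K * d)"
      using False by (intro mult_right_mono order_trans[OF A(1)] power_mono) auto
    also have "\<dots> = real q ^ dim" using Kd by (simp flip: power_add)
    finally have "real ((y ^ ?e) ^ K * c) \<le> real (q ^ dim)" by simp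
    then show ?thesis by (simp only: of_nat_le_iff)
  qed
qed

section \<open>Exceptional families\<close>

lemma divisor_in_filter:
  assumes "\<exists>i\<in>set D. (k::nat) dvd i" and "\<forall>i\<in>set D. 0 < i \<and> i < n"
  shows "k \<in> set (filter (\<lambda>k. \<exists>i\<in>set D. k dvd i) (1 # [2..<n]))"
proof -
  obtain i where i: "i \<in> set D" "k dvd i" using assms(1) by blast
  then have "0 < i" "i < n" using assms(2) by auto
  then have "k \<le> i" "k \<noteq> 0" using i(2) by (auto dest: dvd_imp_le)
  then show ?thesis using assms(1) \<open>i < n\<close> by auto
qed

text \<open>
  In some families the values \<open>\<Phi>\<^sub>3(4) = 21\<close> and \<open>\<Phi>\<^sub>5(3) = 121\<close> are too large for the bound, but
  they have no prime factors \<open>r > M\<close>.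
\<close>

lemma prime_dvd_21_121:
  assumes r: "prime (r::nat)" and dvd: "r dvd y"
  shows "7 < r \<Longrightarrow> y \<noteq> 21" and "11 < r \<Longrightarrow> y \<noteq> 121"
proof -
  have le: "r \<le> max a b" if "y = a * b" "a > 0" "b > 0" for a b
  proof -
    have "r dvd a \<or> r dvd b" using r dvd that(1) prime_dvd_mult_iff by blast
    then show ?thesis using that by (auto dest: dvd_imp_le)
  qed
  show "7 < r \<Longrightarrow> y \<noteq> 21" using le[of 3 7] by auto
  show "11 < r \<Longrightarrow> y \<noteq> 121" using le[of 11 11] by auto
qed

text \<open>
  Used for \<open>q < 7\<close>, with \<open>u\<close> the largest of those values \<open>\<Phi>\<^sub>k(q) ^ e\<close> that have not been ruled out.
\<close>

lemma power_times_le_trans: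
  fixes x :: nat
  assumes "x \<le> u" "u ^ K * c \<le> t"
  shows "x ^ K * c \<le> t"
  using assms by (meson le_trans mult_le_mono1 power_mono zero_le)

text \<open>
  Since only an upper bound for the \<open>r\<close>-part is needed, a twisted order may be replaced by a multiple
  that is a product over degrees: \<open>q\<^sup>8 + q\<^sup>4 + 1\<close> divides \<open>q\<^sup>1\<^sup>2 - 1\<close>.
\<close>

lemma power_bound_Tw3D4:
  assumes q: "q \<ge> 2" and r: "prime r" "\<not> r dvd q"
    and exc: "\<not> lie_exceptional_case Tw3D4 q r"
    and N: "lie_denominator Tw3D4 (int q) * int N = lie_numerator Tw3D4 (int q)"
    and dvd: "int r ^ v dvd lie_numerator Tw3D4 (int q)"
  shows "power_bound Tw3D4 r (r ^ v) N"
proof -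
  let ?D = "[2, 6, 12] :: nat list"
  note q2 = q
  have ks: "k \<in> {1, 2, 3, 4, 6, 12}" if "\<exists>i\<in>set ?D. k dvd i" for k
    using divisor_in_filter[OF that, of 13] by (simp add: upt_rec_numeral del: set_upt set_filter)
  have "int q ^ 20 * int q ^ \<Sum>{2, 6} \<le>
      int q ^ 20 * (2 * (\<Prod>i\<in>{2, 6}. int q ^ i - 1))"
    using q by (intro mult_left_mono prod_power_minus_one_lower) auto
  also have "\<dots> = 2 * (int q ^ 12 * int q ^ 8 * ((int q ^ 6 - 1) * (int q ^ 2 - 1)))"
    by (simp add: mult_ac flip: power_add)
  also have "\<dots> \<le> 2 * (int q ^ 12 * (int q ^ 8 + int q ^ 4 + 1) * ((int q ^ 6 - 1) * (int q ^ 2 - 1)))"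
    using q by (intro mult_left_mono mult_right_mono mult_nonneg_nonneg) (auto simp: one_le_power)
  also have "\<dots> = int (2 * N)" using N by (simp add: mult_ac)
  finally have "int (q ^ 28) \<le> int (2 * N)" by (simp flip: power_add)
  then have lower: "q ^ 28 \<le> 2 * N" by (simp only: of_nat_le_iff)
  have "int q ^ 12 - 1 = (int q ^ 8 + int q ^ 4 + 1) * (int q ^ 4 - 1)" by algebra
  then have part: "int q ^ 8 + int q ^ 4 + 1 dvd int q ^ 12 - 1" by simp
  have "int r ^ v dvd (int q ^ 8 + int q ^ 4 + 1) * ((int q ^ 6 - 1) * (int q ^ 2 - 1))"
    by (rule prime_power_dvd_strip[OF r, of v 12]) (use dvd in \<open>simp add: mult_ac\<close>)
  also have "\<dots> dvd (int q ^ 12 - 1) * ((int q ^ 6 - 1) * (int q ^ 2 - 1))"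
    by (intro mult_dvd_mono part dvd_refl)
  finally have dvd': "int r ^ v dvd (\<Prod>i\<leftarrow>?D. int q ^ i - 1)" by (simp add: mult_ac)
  show ?thesis
  proof (rule exceptional_power_bound_numeric[where K = 6 and M = 12 and cA = 1 and cB = 9
        and LL = 3 and a = 4 and b = 2 and e = 0 and f = 0 and C = 4
        and d = 4 and A = "3 / 2", OF q2 q2 r dvd' lower])
    show "\<forall>i\<in>set ?D. i > 0 \<and> (\<forall>k. k dvd i \<longrightarrow> k \<in> cyclotomic_indices)"
      using ks unfolding cyclotomic_indices_def by auto
  next
    fix k assume "\<exists>i\<in>set ?D. k dvd i"
    then have "k \<in> {1, 2, 3, 4, 6, 12}" by (rule ks)
    then show "cyclotomic_degree k * cyclotomic_exponent ?D k \<le> 4 \<and>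
       (if k = 1 then 1 else if k = 2 then 3 / 2 else 2) ^ cyclotomic_exponent ?D k \<le> real 4 \<and>
       (k = 1 \<or> (7 / 6) ^ cyclotomic_exponent ?D k \<le> (3 / 2 :: real)
         \<or> k = 2 \<and> 10 \<le> (12 :: nat) \<and> (11 / 10) ^ cyclotomic_exponent ?D k \<le> (3 / 2 :: real))"
      by (elim insertE) (simp_all add: cyclotomic_exponent_def cyclotomic_degree_def power_divide)
  next
    let ?y = "\<lambda>k. nat (cyclotomic_value k (int q))"
    fix k assume "\<exists>i\<in>set ?D. k dvd i" and q7: "q < 7" and rM: "12 < r"
      and ry: "r dvd ?y k" "r \<le> ?y k"
    then have k: "k \<in> {1, 2, 3, 4, 6, 12}" using ks by blast
    note composite = prime_dvd_21_121[OF r(1) ry(1)]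
    have excluded: "q = 3 \<Longrightarrow> ?y k \<noteq> 13"
      using primes_dvd_imp_eq[OF r(1), of 13] ry(1) exc
      by (auto simp: lie_exceptional_case_def)
    consider "q = 2" | "q = 3" | "q = 4" | "q = 5" | "q = 6" using q q7 by linarith
    then show "(?y k ^ cyclotomic_exponent ?D k) ^ 6 * 2 \<le> q ^ 28"
    proof cases
      case 1
      have "?y k ^ cyclotomic_exponent ?D k \<le> 13"
        using k rM ry(2) composite excluded unfolding 1
        by (elim insertE) (simp_all add: cyclotomic_value_def cyclotomic_exponent_def)
      then show ?thesis by (rule power_times_le_trans) (simp add: 1)
    next
      case 2
      have "?y k ^ cyclotomic_exponent ?D k \<le> 73"
        using k rM ry(2) composite excluded unfolding 2
        by (elim insertE) (simp_all add: cyclotomic_value_def cyclotomic_exponent_def)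
      then show ?thesis by (rule power_times_le_trans) (simp add: 2)
    next
      case 3
      have "?y k ^ cyclotomic_exponent ?D k \<le> 241"
        using k rM ry(2) composite excluded unfolding 3
        by (elim insertE) (simp_all add: cyclotomic_value_def cyclotomic_exponent_def)
      then show ?thesis by (rule power_times_le_trans) (simp add: 3)
    next
      case 4
      have "?y k ^ cyclotomic_exponent ?D k \<le> 961"
        using k rM ry(2) composite excluded unfolding 4
        by (elim insertE) (simp_all add: cyclotomic_value_def cyclotomic_exponent_def)
      then show ?thesis by (rule power_times_le_trans) (simp add: 4)
    next
      case 5
      have "?y k ^ cyclotomic_exponent ?D k \<le> 1849"
        using k rM ry(2) composite excluded unfolding 5
        by (elim insertE) (simp_all add: cyclotomic_value_def cyclotomic_exponent_def)
      then show ?thesis by (rule power_times_le_trans) (simp add: 5)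
    qed
  qed (simp_all add: power_divide)
qed

lemma power_bound_LieE6:
  assumes q: "q \<ge> 2" and r: "prime r" "\<not> r dvd q"
    and exc: "\<not> lie_exceptional_case LieE6 q r"
    and N: "lie_denominator LieE6 (int q) * int N = lie_numerator LieE6 (int q)"
    and dvd: "int r ^ v dvd lie_numerator LieE6 (int q)"
  shows "power_bound LieE6 r (r ^ v) N"
proof -
  let ?D = "[2, 5, 6, 8, 9, 12] :: nat list"
  note q2 = q
  have ks: "k \<in> {1, 2, 3, 4, 5, 6, 8, 9, 12}" if "\<exists>i\<in>set ?D. k dvd i" for k
    using divisor_in_filter[OF that, of 13] by (simp add: upt_rec_numeral del: set_upt set_filter)
  have "int q ^ 36 * int q ^ \<Sum>{2, 5, 6, 8, 9, 12} \<le>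
      int q ^ 36 * (2 * (\<Prod>i\<in>{2, 5, 6, 8, 9, 12}. int q ^ i - 1))"
    using q by (intro mult_left_mono prod_power_minus_one_lower) auto
  also have "\<dots> = 2 * (gcd 3 (int q - 1) * int N)" using N by simp
  also have "\<dots> \<le> 2 * (3 * int N)" by (intro mult_left_mono mult_right_mono gcd_le1_int) auto
  also have "\<dots> = int (6 * N)" by simp
  finally have "int (q ^ 78) \<le> int (6 * N)" by (simp flip: power_add)
  then have lower: "q ^ 78 \<le> 6 * N" by (simp only: of_nat_le_iff)
  have "int r ^ v dvd (\<Prod>i\<in>{2, 5, 6, 8, 9, 12}. int q ^ i - 1)"
    by (rule prime_power_dvd_strip[OF r, of v 36]) (use dvd in simp)
  then have dvd': "int r ^ v dvd (\<Prod>i\<leftarrow>?D. int q ^ i - 1)" by simp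
  show ?thesis
  proof (rule exceptional_power_bound_numeric[where K = 12 and M = 12 and cA = 5 and cB = 81
        and LL = 3 and a = 7 and b = 4 and e = 1 and f = 0 and C = 8
        and d = 6 and A = "8 / 5", OF q2 q2 r dvd' lower])
    show "\<forall>i\<in>set ?D. i > 0 \<and> (\<forall>k. k dvd i \<longrightarrow> k \<in> cyclotomic_indices)"
      using ks unfolding cyclotomic_indices_def by auto
  next
    fix k assume "\<exists>i\<in>set ?D. k dvd i"
    then have "k \<in> {1, 2, 3, 4, 5, 6, 8, 9, 12}" by (rule ks)
    then show "cyclotomic_degree k * cyclotomic_exponent ?D k \<le> 6 \<and>
       (if k = 1 then 1 else if k = 2 then 3 / 2 else 2) ^ cyclotomic_exponent ?D k \<le> real 8 \<and>
       (k = 1 \<or> (7 / 6) ^ cyclotomic_exponent ?D k \<le> (8 / 5 :: real)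
         \<or> k = 2 \<and> 10 \<le> (12 :: nat) \<and> (11 / 10) ^ cyclotomic_exponent ?D k \<le> (8 / 5 :: real))"
      by (elim insertE) (simp_all add: cyclotomic_exponent_def cyclotomic_degree_def power_divide)
  next
    let ?y = "\<lambda>k. nat (cyclotomic_value k (int q))"
    fix k assume "\<exists>i\<in>set ?D. k dvd i" and q7: "q < 7" and rM: "12 < r"
      and ry: "r dvd ?y k" "r \<le> ?y k"
    then have k: "k \<in> {1, 2, 3, 4, 5, 6, 8, 9, 12}" using ks by blast
    note composite = prime_dvd_21_121[OF r(1) ry(1)]
    have excluded: "q = 3 \<Longrightarrow> ?y k \<noteq> 13"
      using primes_dvd_imp_eq[OF r(1), of 13] ry(1) exc
      by (auto simp: lie_exceptional_case_def)
    consider "q = 2" | "q = 3" | "q = 4" | "q = 5" | "q = 6" using q q7 by linarith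
    then show "(?y k ^ cyclotomic_exponent ?D k) ^ 12 * 6 \<le> q ^ 78"
    proof cases
      case 1
      have "?y k ^ cyclotomic_exponent ?D k \<le> 73"
        using k rM ry(2) composite excluded unfolding 1
        by (elim insertE) (simp_all add: cyclotomic_value_def cyclotomic_exponent_def)
      then show ?thesis by (rule power_times_le_trans) (simp add: 1)
    next
      case 2
      have "?y k ^ cyclotomic_exponent ?D k \<le> 757"
        using k rM ry(2) composite excluded unfolding 2
        by (elim insertE) (simp_all add: cyclotomic_value_def cyclotomic_exponent_def)
      then show ?thesis by (rule power_times_le_trans) (simp add: 2)
    next
      case 3
      have "?y k ^ cyclotomic_exponent ?D k \<le> 4161"
        using k rM ry(2) composite excluded unfolding 3
        by (elim insertE) (simp_all add: cyclotomic_value_def cyclotomic_exponent_def)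
      then show ?thesis by (rule power_times_le_trans) (simp add: 3)
    next
      case 4
      have "?y k ^ cyclotomic_exponent ?D k \<le> 29791"
        using k rM ry(2) composite excluded unfolding 4
        by (elim insertE) (simp_all add: cyclotomic_value_def cyclotomic_exponent_def)
      then show ?thesis by (rule power_times_le_trans) (simp add: 4)
    next
      case 5
      have "?y k ^ cyclotomic_exponent ?D k \<le> 79507"
        using k rM ry(2) composite excluded unfolding 5
        by (elim insertE) (simp_all add: cyclotomic_value_def cyclotomic_exponent_def)
      then show ?thesis by (rule power_times_le_trans) (simp add: 5)
    qed
  qed (simp_all add: power_divide)
qed

text \<open>
  The factors \<open>q\<^sup>9 + 1\<close> and \<open>q\<^sup>5 + 1\<close> are enlarged to \<open>q\<^sup>1\<^sup>8 - 1\<close> and \<open>q\<^sup>1\<^sup>0 - 1\<close>.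
\<close>

lemma power_bound_Tw2E6:
  assumes q: "q \<ge> 2" and r: "prime r" "\<not> r dvd q"
    and N: "lie_denominator Tw2E6 (int q) * int N = lie_numerator Tw2E6 (int q)"
    and dvd: "int r ^ v dvd lie_numerator Tw2E6 (int q)"
  shows "power_bound Tw2E6 r (r ^ v) N"
proof -
  let ?D = "[2, 6, 8, 10, 12, 18] :: nat list"
  note q2 = q
  have ks: "k \<in> {1, 2, 3, 4, 5, 6, 8, 9, 10, 12, 18}" if "\<exists>i\<in>set ?D. k dvd i" for k
    using divisor_in_filter[OF that, of 19] by (simp add: upt_rec_numeral del: set_upt set_filter)
  have "int q ^ 36 * int q ^ \<Sum>{2, 5, 6, 8, 9, 12} \<le>
      int q ^ 36 * (2 * (\<Prod>i\<in>{2, 5, 6, 8, 9, 12}. int q ^ i - 1))"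
    using q by (intro mult_left_mono prod_power_minus_one_lower) auto
  also have "\<dots> = 2 * (int q ^ 36 * (int q ^ 12 - 1) * (int q ^ 9 - 1) * (int q ^ 8 - 1) *
      (int q ^ 6 - 1) * (int q ^ 5 - 1) * (int q ^ 2 - 1))"
    by (simp add: mult_ac)
  also have "\<dots> \<le> 2 * (int q ^ 36 * (int q ^ 12 - 1) * (int q ^ 9 + 1) * (int q ^ 8 - 1) *
      (int q ^ 6 - 1) * (int q ^ 5 + 1) * (int q ^ 2 - 1))"
    using q by (intro mult_left_mono mult_mono mult_nonneg_nonneg) (auto simp: one_le_power)
  also have "\<dots> = 2 * (gcd 3 (int q + 1) * int N)" using N by simp
  also have "\<dots> \<le> 2 * (3 * int N)" by (intro mult_left_mono mult_right_mono gcd_le1_int) auto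
  also have "\<dots> = int (6 * N)" by simp
  finally have "int (q ^ 78) \<le> int (6 * N)" by (simp flip: power_add)
  then have lower: "q ^ 78 \<le> 6 * N" by (simp only: of_nat_le_iff)
  have "int q ^ 18 - 1 = (int q ^ 9 + 1) * (int q ^ 9 - 1)"
    "int q ^ 10 - 1 = (int q ^ 5 + 1) * (int q ^ 5 - 1)" by algebra+
  then have parts: "int q ^ 9 + 1 dvd int q ^ 18 - 1" "int q ^ 5 + 1 dvd int q ^ 10 - 1" by simp_all
  have "int r ^ v dvd (int q ^ 12 - 1) * ((int q ^ 9 + 1) * ((int q ^ 8 - 1) * ((int q ^ 6 - 1) *
      ((int q ^ 5 + 1) * (int q ^ 2 - 1)))))"
    by (rule prime_power_dvd_strip[OF r, of v 36]) (use dvd in \<open>simp add: mult_ac\<close>)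
  also have "\<dots> dvd (int q ^ 12 - 1) * ((int q ^ 18 - 1) * ((int q ^ 8 - 1) * ((int q ^ 6 - 1) *
      ((int q ^ 10 - 1) * (int q ^ 2 - 1)))))"
    by (intro mult_dvd_mono parts dvd_refl)
  finally have dvd': "int r ^ v dvd (\<Prod>i\<leftarrow>?D. int q ^ i - 1)" by (simp add: mult_ac)
  show ?thesis
  proof (rule exceptional_power_bound_numeric[where K = 12 and M = 18 and cA = 5 and cB = 81
        and LL = 4 and a = 9 and b = 4 and e = 1 and f = 0 and C = 12
        and d = 6 and A = "9 / 5", OF q2 q2 r dvd' lower])
    show "\<forall>i\<in>set ?D. i > 0 \<and> (\<forall>k. k dvd i \<longrightarrow> k \<in> cyclotomic_indices)"
      using ks unfolding cyclotomic_indices_def by auto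
  next
    fix k assume "\<exists>i\<in>set ?D. k dvd i"
    then have "k \<in> {1, 2, 3, 4, 5, 6, 8, 9, 10, 12, 18}" by (rule ks)
    then show "cyclotomic_degree k * cyclotomic_exponent ?D k \<le> 6 \<and>
       (if k = 1 then 1 else if k = 2 then 3 / 2 else 2) ^ cyclotomic_exponent ?D k \<le> real 12 \<and>
       (k = 1 \<or> (7 / 6) ^ cyclotomic_exponent ?D k \<le> (9 / 5 :: real)
         \<or> k = 2 \<and> 10 \<le> (18 :: nat) \<and> (11 / 10) ^ cyclotomic_exponent ?D k \<le> (9 / 5 :: real))"
      by (elim insertE) (simp_all add: cyclotomic_exponent_def cyclotomic_degree_def power_divide)
  next
    let ?y = "\<lambda>k. nat (cyclotomic_value k (int q))"
    fix k assume "\<exists>i\<in>set ?D. k dvd i" and q7: "q < 7" and rM: "18 < r"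
      and ry: "r dvd ?y k" "r \<le> ?y k"
    then have k: "k \<in> {1, 2, 3, 4, 5, 6, 8, 9, 10, 12, 18}" using ks by blast
    note composite = prime_dvd_21_121[OF r(1) ry(1)]
    consider "q = 2" | "q = 3" | "q = 4" | "q = 5" | "q = 6" using q q7 by linarith
    then show "(?y k ^ cyclotomic_exponent ?D k) ^ 12 * 6 \<le> q ^ 78"
    proof cases
      case 1
      have "?y k ^ cyclotomic_exponent ?D k \<le> 73"
        using k rM ry(2) composite unfolding 1
        by (elim insertE) (simp_all add: cyclotomic_value_def cyclotomic_exponent_def)
      then show ?thesis by (rule power_times_le_trans) (simp add: 1)
    next
      case 2
      have "?y k ^ cyclotomic_exponent ?D k \<le> 757"
        using k rM ry(2) composite unfolding 2
        by (elim insertE) (simp_all add: cyclotomic_value_def cyclotomic_exponent_def)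
      then show ?thesis by (rule power_times_le_trans) (simp add: 2)
    next
      case 3
      have "?y k ^ cyclotomic_exponent ?D k \<le> 4161"
        using k rM ry(2) composite unfolding 3
        by (elim insertE) (simp_all add: cyclotomic_value_def cyclotomic_exponent_def)
      then show ?thesis by (rule power_times_le_trans) (simp add: 3)
    next
      case 4
      have "?y k ^ cyclotomic_exponent ?D k \<le> 29791"
        using k rM ry(2) composite unfolding 4
        by (elim insertE) (simp_all add: cyclotomic_value_def cyclotomic_exponent_def)
      then show ?thesis by (rule power_times_le_trans) (simp add: 4)
    next
      case 5
      have "?y k ^ cyclotomic_exponent ?D k \<le> 79507"
        using k rM ry(2) composite unfolding 5
        by (elim insertE) (simp_all add: cyclotomic_value_def cyclotomic_exponent_def)
      then show ?thesis by (rule power_times_le_trans) (simp add: 5)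
    qed
  qed (simp_all add: power_divide)
qed

lemma power_bound_LieE7:
  assumes q: "q \<ge> 2" and r: "prime r" "\<not> r dvd q"
    and N: "lie_denominator LieE7 (int q) * int N = lie_numerator LieE7 (int q)"
    and dvd: "int r ^ v dvd lie_numerator LieE7 (int q)"
  shows "power_bound LieE7 r (r ^ v) N"
proof -
  let ?D = "[2, 6, 8, 10, 12, 14, 18] :: nat list"
  note q2 = q
  have ks: "k \<in> {1, 2, 3, 4, 5, 6, 7, 8, 9, 10, 12, 14, 18}" if "\<exists>i\<in>set ?D. k dvd i" for k
    using divisor_in_filter[OF that, of 19] by (simp add: upt_rec_numeral del: set_upt set_filter)
  have "int q ^ 63 * int q ^ \<Sum>{2, 6, 8, 10, 12, 14, 18} \<le>
      int q ^ 63 * (2 * (\<Prod>i\<in>{2, 6, 8, 10, 12, 14, 18}. int q ^ i - 1))"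
    using q by (intro mult_left_mono prod_power_minus_one_lower) auto
  also have "\<dots> = 2 * (gcd 2 (int q - 1) * int N)" using N by simp
  also have "\<dots> \<le> 2 * (2 * int N)" by (intro mult_left_mono mult_right_mono gcd_le1_int) auto
  also have "\<dots> = int (4 * N)" by simp
  finally have "int (q ^ 133) \<le> int (4 * N)" by (simp flip: power_add)
  then have lower: "q ^ 133 \<le> 4 * N" by (simp only: of_nat_le_iff)
  have "int r ^ v dvd (\<Prod>i\<in>{2, 6, 8, 10, 12, 14, 18}. int q ^ i - 1)"
    by (rule prime_power_dvd_strip[OF r, of v 63]) (use dvd in simp)
  then have dvd': "int r ^ v dvd (\<Prod>i\<leftarrow>?D. int q ^ i - 1)" by simp
  show ?thesis
  proof (rule exceptional_power_bound_numeric[where K = 18 and M = 18 and cA = 7 and cB = 81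
        and LL = 4 and a = 10 and b = 4 and e = 1 and f = 1 and C = 18
        and d = 7 and A = "1949 / 1000", OF q2 q2 r dvd' lower])
    show "\<forall>i\<in>set ?D. i > 0 \<and> (\<forall>k. k dvd i \<longrightarrow> k \<in> cyclotomic_indices)"
      using ks unfolding cyclotomic_indices_def by auto
  next
    fix k assume "\<exists>i\<in>set ?D. k dvd i"
    then have "k \<in> {1, 2, 3, 4, 5, 6, 7, 8, 9, 10, 12, 14, 18}" by (rule ks)
    then show "cyclotomic_degree k * cyclotomic_exponent ?D k \<le> 7 \<and>
       (if k = 1 then 1 else if k = 2 then 3 / 2 else 2) ^ cyclotomic_exponent ?D k \<le> real 18 \<and>
       (k = 1 \<or> (7 / 6) ^ cyclotomic_exponent ?D k \<le> (1949 / 1000 :: real)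
         \<or> k = 2 \<and> 10 \<le> (18 :: nat) \<and> (11 / 10) ^ cyclotomic_exponent ?D k \<le> (1949 / 1000 :: real))"
      by (elim insertE) (simp_all add: cyclotomic_exponent_def cyclotomic_degree_def power_divide)
  next
    let ?y = "\<lambda>k. nat (cyclotomic_value k (int q))"
    fix k assume "\<exists>i\<in>set ?D. k dvd i" and q7: "q < 7" and rM: "18 < r"
      and ry: "r dvd ?y k" "r \<le> ?y k"
    then have k: "k \<in> {1, 2, 3, 4, 5, 6, 7, 8, 9, 10, 12, 14, 18}" using ks by blast
    note composite = prime_dvd_21_121[OF r(1) ry(1)]
    consider "q = 2" | "q = 3" | "q = 4" | "q = 5" | "q = 6" using q q7 by linarith
    then show "(?y k ^ cyclotomic_exponent ?D k) ^ 18 * 4 \<le> q ^ 133"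
    proof cases
      case 1
      have "?y k ^ cyclotomic_exponent ?D k \<le> 127"
        using k rM ry(2) composite unfolding 1
        by (elim insertE) (simp_all add: cyclotomic_value_def cyclotomic_exponent_def)
      then show ?thesis by (rule power_times_le_trans) (simp add: 1)
    next
      case 2
      have "?y k ^ cyclotomic_exponent ?D k \<le> 1093"
        using k rM ry(2) composite unfolding 2
        by (elim insertE) (simp_all add: cyclotomic_value_def cyclotomic_exponent_def)
      then show ?thesis by (rule power_times_le_trans) (simp add: 2)
    next
      case 3
      have "?y k ^ cyclotomic_exponent ?D k \<le> 5461"
        using k rM ry(2) composite unfolding 3
        by (elim insertE) (simp_all add: cyclotomic_value_def cyclotomic_exponent_def)
      then show ?thesis by (rule power_times_le_trans) (simp add: 3)
    next
      case 4
      have "?y k ^ cyclotomic_exponent ?D k \<le> 29791"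
        using k rM ry(2) composite unfolding 4
        by (elim insertE) (simp_all add: cyclotomic_value_def cyclotomic_exponent_def)
      then show ?thesis by (rule power_times_le_trans) (simp add: 4)
    next
      case 5
      have "?y k ^ cyclotomic_exponent ?D k \<le> 79507"
        using k rM ry(2) composite unfolding 5
        by (elim insertE) (simp_all add: cyclotomic_value_def cyclotomic_exponent_def)
      then show ?thesis by (rule power_times_le_trans) (simp add: 5)
    qed
  qed (simp_all add: power_divide)
qed

lemma power_bound_LieE8:
  assumes q: "q \<ge> 2" and r: "prime r" "\<not> r dvd q"
    and exc: "\<not> lie_exceptional_case LieE8 q r"
    and N: "lie_denominator LieE8 (int q) * int N = lie_numerator LieE8 (int q)"
    and dvd: "int r ^ v dvd lie_numerator LieE8 (int q)"
  shows "power_bound LieE8 r (r ^ v) N"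
proof -
  let ?D = "[2, 8, 12, 14, 18, 20, 24, 30] :: nat list"
  note q2 = q
  have ks: "k \<in> {1, 2, 3, 4, 5, 6, 7, 8, 9, 10, 12, 14, 15, 18, 20, 24, 30}" if "\<exists>i\<in>set ?D. k dvd i" for k
    using divisor_in_filter[OF that, of 31] by (simp add: upt_rec_numeral del: set_upt set_filter)
  have "int q ^ 120 * int q ^ \<Sum>{2, 8, 12, 14, 18, 20, 24, 30} \<le>
      int q ^ 120 * (2 * (\<Prod>i\<in>{2, 8, 12, 14, 18, 20, 24, 30}. int q ^ i - 1))"
    using q by (intro mult_left_mono prod_power_minus_one_lower) auto
  also have "\<dots> = int (2 * N)" using N by simp
  finally have "int (q ^ 248) \<le> int (2 * N)" by (simp flip: power_add)
  then have lower: "q ^ 248 \<le> 2 * N" by (simp only: of_nat_le_iff)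
  have "int r ^ v dvd (\<Prod>i\<in>{2, 8, 12, 14, 18, 20, 24, 30}. int q ^ i - 1)"
    by (rule prime_power_dvd_strip[OF r, of v 120]) (use dvd in simp)
  then have dvd': "int r ^ v dvd (\<Prod>i\<leftarrow>?D. int q ^ i - 1)" by simp
  show ?thesis
  proof (rule exceptional_power_bound_numeric[where K = 29 and M = 30 and cA = 7 and cB = 243
        and LL = 4 and a = 14 and b = 5 and e = 2 and f = 1 and C = 26
        and d = 8 and A = "11 / 5", OF q2 q2 r dvd' lower])
    show "\<forall>i\<in>set ?D. i > 0 \<and> (\<forall>k. k dvd i \<longrightarrow> k \<in> cyclotomic_indices)"
      using ks unfolding cyclotomic_indices_def by auto
  next
    fix k assume "\<exists>i\<in>set ?D. k dvd i"
    then have "k \<in> {1, 2, 3, 4, 5, 6, 7, 8, 9, 10, 12, 14, 15, 18, 20, 24, 30}" by (rule ks)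
    then show "cyclotomic_degree k * cyclotomic_exponent ?D k \<le> 8 \<and>
       (if k = 1 then 1 else if k = 2 then 3 / 2 else 2) ^ cyclotomic_exponent ?D k \<le> real 26 \<and>
       (k = 1 \<or> (7 / 6) ^ cyclotomic_exponent ?D k \<le> (11 / 5 :: real)
         \<or> k = 2 \<and> 10 \<le> (30 :: nat) \<and> (11 / 10) ^ cyclotomic_exponent ?D k \<le> (11 / 5 :: real))"
      by (elim insertE) (simp_all add: cyclotomic_exponent_def cyclotomic_degree_def power_divide)
  next
    let ?y = "\<lambda>k. nat (cyclotomic_value k (int q))"
    fix k assume "\<exists>i\<in>set ?D. k dvd i" and q7: "q < 7" and rM: "30 < r"
      and ry: "r dvd ?y k" "r \<le> ?y k"
    then have k: "k \<in> {1, 2, 3, 4, 5, 6, 7, 8, 9, 10, 12, 14, 15, 18, 20, 24, 30}" using ks by blast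
    note composite = prime_dvd_21_121[OF r(1) ry(1)]
    have excluded: "q = 2 \<Longrightarrow> ?y k \<noteq> 31"
      using primes_dvd_imp_eq[OF r(1), of 31] ry(1) exc
      by (auto simp: lie_exceptional_case_def)
    consider "q = 2" | "q = 3" | "q = 4" | "q = 5" | "q = 6" using q q7 by linarith
    then show "(?y k ^ cyclotomic_exponent ?D k) ^ 29 * 2 \<le> q ^ 248"
    proof cases
      case 1
      have "?y k ^ cyclotomic_exponent ?D k \<le> 331"
        using k rM ry(2) composite excluded unfolding 1
        by (elim insertE) (simp_all add: cyclotomic_value_def cyclotomic_exponent_def)
      then show ?thesis by (rule power_times_le_trans) (simp add: 1)
    next
      case 2
      have "?y k ^ cyclotomic_exponent ?D k \<le> 8401"
        using k rM ry(2) composite excluded unfolding 2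
        by (elim insertE) (simp_all add: cyclotomic_value_def cyclotomic_exponent_def)
      then show ?thesis by (rule power_times_le_trans) (simp add: 2)
    next
      case 3
      have "?y k ^ cyclotomic_exponent ?D k \<le> 116281"
        using k rM ry(2) composite excluded unfolding 3
        by (elim insertE) (simp_all add: cyclotomic_value_def cyclotomic_exponent_def)
      then show ?thesis by (rule power_times_le_trans) (simp add: 3)
    next
      case 4
      have "?y k ^ cyclotomic_exponent ?D k \<le> 923521"
        using k rM ry(2) composite excluded unfolding 4
        by (elim insertE) (simp_all add: cyclotomic_value_def cyclotomic_exponent_def)
      then show ?thesis by (rule power_times_le_trans) (simp add: 4)
    next
      case 5
      have "?y k ^ cyclotomic_exponent ?D k \<le> 3418801"
        using k rM ry(2) composite excluded unfolding 5
        by (elim insertE) (simp_all add: cyclotomic_value_def cyclotomic_exponent_def)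
      then show ?thesis by (rule power_times_le_trans) (simp add: 5)
    qed
  qed (simp_all add: power_divide)
qed

lemma power_bound_LieF4:
  assumes q: "q \<ge> 2" and r: "prime r" "\<not> r dvd q"
    and exc: "\<not> lie_exceptional_case LieF4 q r"
    and N: "lie_denominator LieF4 (int q) * int N = lie_numerator LieF4 (int q)"
    and dvd: "int r ^ v dvd lie_numerator LieF4 (int q)"
  shows "power_bound LieF4 r (r ^ v) N"
proof -
  let ?D = "[2, 6, 8, 12] :: nat list"
  note q2 = q
  have ks: "k \<in> {1, 2, 3, 4, 6, 8, 12}" if "\<exists>i\<in>set ?D. k dvd i" for k
    using divisor_in_filter[OF that, of 13] by (simp add: upt_rec_numeral del: set_upt set_filter)
  have "int q ^ 24 * int q ^ \<Sum>{2, 6, 8, 12} \<le>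
      int q ^ 24 * (2 * (\<Prod>i\<in>{2, 6, 8, 12}. int q ^ i - 1))"
    using q by (intro mult_left_mono prod_power_minus_one_lower) auto
  also have "\<dots> = int (2 * N)" using N by simp
  finally have "int (q ^ 52) \<le> int (2 * N)" by (simp flip: power_add)
  then have lower: "q ^ 52 \<le> 2 * N" by (simp only: of_nat_le_iff)
  have "int r ^ v dvd (\<Prod>i\<in>{2, 6, 8, 12}. int q ^ i - 1)"
    by (rule prime_power_dvd_strip[OF r, of v 24]) (use dvd in simp)
  then have dvd': "int r ^ v dvd (\<Prod>i\<leftarrow>?D. int q ^ i - 1)" by simp
  show ?thesis
  proof (rule exceptional_power_bound_numeric[where K = 12 and M = 12 and cA = 1 and cB = 9
        and LL = 3 and a = 7 and b = 2 and e = 0 and f = 0 and C = 6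
        and d = 4 and A = "3 / 2", OF q2 q2 r dvd' lower])
    show "\<forall>i\<in>set ?D. i > 0 \<and> (\<forall>k. k dvd i \<longrightarrow> k \<in> cyclotomic_indices)"
      using ks unfolding cyclotomic_indices_def by auto
  next
    fix k assume "\<exists>i\<in>set ?D. k dvd i"
    then have "k \<in> {1, 2, 3, 4, 6, 8, 12}" by (rule ks)
    then show "cyclotomic_degree k * cyclotomic_exponent ?D k \<le> 4 \<and>
       (if k = 1 then 1 else if k = 2 then 3 / 2 else 2) ^ cyclotomic_exponent ?D k \<le> real 6 \<and>
       (k = 1 \<or> (7 / 6) ^ cyclotomic_exponent ?D k \<le> (3 / 2 :: real)
         \<or> k = 2 \<and> 10 \<le> (12 :: nat) \<and> (11 / 10) ^ cyclotomic_exponent ?D k \<le> (3 / 2 :: real))"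
      by (elim insertE) (simp_all add: cyclotomic_exponent_def cyclotomic_degree_def power_divide)
  next
    let ?y = "\<lambda>k. nat (cyclotomic_value k (int q))"
    fix k assume "\<exists>i\<in>set ?D. k dvd i" and q7: "q < 7" and rM: "12 < r"
      and ry: "r dvd ?y k" "r \<le> ?y k"
    then have k: "k \<in> {1, 2, 3, 4, 6, 8, 12}" using ks by blast
    note composite = prime_dvd_21_121[OF r(1) ry(1)]
    have excluded: "q = 3 \<Longrightarrow> ?y k \<noteq> 13"
      using primes_dvd_imp_eq[OF r(1), of 13] ry(1) exc
      by (auto simp: lie_exceptional_case_def)
    consider "q = 2" | "q = 3" | "q = 4" | "q = 5" | "q = 6" using q q7 by linarith
    then show "(?y k ^ cyclotomic_exponent ?D k) ^ 12 * 2 \<le> q ^ 52"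
    proof cases
      case 1
      have "?y k ^ cyclotomic_exponent ?D k \<le> 17"
        using k rM ry(2) composite excluded unfolding 1
        by (elim insertE) (simp_all add: cyclotomic_value_def cyclotomic_exponent_def)
      then show ?thesis by (rule power_times_le_trans) (simp add: 1)
    next
      case 2
      have "?y k ^ cyclotomic_exponent ?D k \<le> 82"
        using k rM ry(2) composite excluded unfolding 2
        by (elim insertE) (simp_all add: cyclotomic_value_def cyclotomic_exponent_def)
      then show ?thesis by (rule power_times_le_trans) (simp add: 2)
    next
      case 3
      have "?y k ^ cyclotomic_exponent ?D k \<le> 289"
        using k rM ry(2) composite excluded unfolding 3
        by (elim insertE) (simp_all add: cyclotomic_value_def cyclotomic_exponent_def)
      then show ?thesis by (rule power_times_le_trans) (simp add: 3)
    next
      case 4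
      have "?y k ^ cyclotomic_exponent ?D k \<le> 961"
        using k rM ry(2) composite excluded unfolding 4
        by (elim insertE) (simp_all add: cyclotomic_value_def cyclotomic_exponent_def)
      then show ?thesis by (rule power_times_le_trans) (simp add: 4)
    next
      case 5
      have "?y k ^ cyclotomic_exponent ?D k \<le> 1849"
        using k rM ry(2) composite excluded unfolding 5
        by (elim insertE) (simp_all add: cyclotomic_value_def cyclotomic_exponent_def)
      then show ?thesis by (rule power_times_le_trans) (simp add: 5)
    qed
  qed (simp_all add: power_divide)
qed

text \<open>
  The factors \<open>q\<^sup>6 + 1\<close> and \<open>q\<^sup>3 + 1\<close> are enlarged to \<open>q\<^sup>1\<^sup>2 - 1\<close> and \<open>q\<^sup>6 - 1\<close>. Of
  the shape \<open>q = 2 ^ (2 m + 1)\<close> only the parity and the gap between 2 and 8 matter. The constant 4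
  in the lower bound for the order also covers the index 2 of the Tits group.
\<close>

lemma power_bound_Tw2F4:
  assumes q: "q = 2 \<or> q \<ge> 8" "even q" and r: "prime r" "\<not> r dvd q"
    and N: "lie_denominator Tw2F4 (int q) * int N = lie_numerator Tw2F4 (int q)"
    and dvd: "int r ^ v dvd lie_numerator Tw2F4 (int q)"
  shows "power_bound Tw2F4 r (r ^ v) N"
proof -
  let ?D = "[1, 4, 6, 12] :: nat list"
  have q2: "q \<ge> 2" using q by auto
  have ks: "k \<in> {1, 2, 3, 4, 6, 12}" if "\<exists>i\<in>set ?D. k dvd i" for k
    using divisor_in_filter[OF that, of 13] by (simp add: upt_rec_numeral del: set_upt set_filter)
  have lower: "q ^ 26 \<le> 4 * N"
  proof (cases "q = 2")
    case True
    then show ?thesis using N by simp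
  next
    case False
    have "int q \<le> 2 * (int q - 1)" using q2 by simp
    moreover have "1 \<le> int q ^ 4 - 1"
      using power_increasing[of 1 4 "int q"] q2 by simp
    then have "int q ^ 4 \<le> 2 * (int q ^ 4 - 1)" by simp
    ultimately have "int q ^ 12 * int q ^ 6 * int q ^ 4 * int q ^ 3 * int q
        \<le> int q ^ 12 * (int q ^ 6 + 1) * (2 * (int q ^ 4 - 1)) * (int q ^ 3 + 1) * (2 * (int q - 1))"
      using q2 by (intro mult_mono mult_nonneg_nonneg) (auto simp: one_le_power)
    also have "\<dots> = 4 * (int q ^ 12 * (int q ^ 6 + 1) * (int q ^ 4 - 1) * (int q ^ 3 + 1) * (int q - 1))"
      by algebra
    also have "\<dots> = int (4 * N)" using N False by simp
    also have "int q ^ 12 * int q ^ 6 * int q ^ 4 * int q ^ 3 * int q = int (q ^ 26)"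
      by (simp flip: power_add power_Suc2)
    finally show ?thesis by (simp only: of_nat_le_iff)
  qed
  have "int q ^ 12 - 1 = (int q ^ 6 + 1) * (int q ^ 6 - 1)"
    "int q ^ 6 - 1 = (int q ^ 3 + 1) * (int q ^ 3 - 1)" by algebra+
  then have parts: "int q ^ 6 + 1 dvd int q ^ 12 - 1" "int q ^ 3 + 1 dvd int q ^ 6 - 1"
    by (metis dvd_triv_left)+
  have "int r ^ v dvd (int q ^ 6 + 1) * ((int q ^ 4 - 1) * ((int q ^ 3 + 1) * (int q - 1)))"
    by (rule prime_power_dvd_strip[OF r, of v 12]) (use dvd in \<open>simp add: mult_ac\<close>)
  also have "\<dots> dvd (int q ^ 12 - 1) * ((int q ^ 4 - 1) * ((int q ^ 6 - 1) * (int q - 1)))"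
    by (intro mult_dvd_mono parts dvd_refl)
  finally have dvd': "int r ^ v dvd (\<Prod>i\<leftarrow>?D. int q ^ i - 1)" by (simp add: mult_ac)
  show ?thesis
  proof (rule exceptional_power_bound_numeric[where K = 6 and M = 12 and cA = 1 and cB = 9
        and LL = 3 and a = 5 and b = 2 and e = 0 and f = 0 and C = 4
        and d = 4 and A = "7 / 5", OF q2 q2 r dvd' lower])
    show "\<forall>i\<in>set ?D. i > 0 \<and> (\<forall>k. k dvd i \<longrightarrow> k \<in> cyclotomic_indices)"
      using ks unfolding cyclotomic_indices_def by auto
    show "2 ^ 3 \<le> 12 \<and> 4 \<le> (9::nat) \<and> 6 * (2 * length ?D + 5) + 2 * (3 + 1) \<le> 26 * (3 + 1)"
      if "odd q" using that q by simp
  next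
    fix k assume "\<exists>i\<in>set ?D. k dvd i"
    then have "k \<in> {1, 2, 3, 4, 6, 12}" by (rule ks)
    then show "cyclotomic_degree k * cyclotomic_exponent ?D k \<le> 4 \<and>
       (if k = 1 then 1 else if k = 2 then 3 / 2 else 2) ^ cyclotomic_exponent ?D k \<le> real 4 \<and>
       (k = 1 \<or> (7 / 6) ^ cyclotomic_exponent ?D k \<le> (7 / 5 :: real)
         \<or> k = 2 \<and> 10 \<le> (12 :: nat) \<and> (11 / 10) ^ cyclotomic_exponent ?D k \<le> (7 / 5 :: real))"
      by (elim insertE) (simp_all add: cyclotomic_exponent_def cyclotomic_degree_def power_divide)
  next
    let ?y = "\<lambda>k. nat (cyclotomic_value k (int q))"
    fix k assume "\<exists>i\<in>set ?D. k dvd i" and q7: "q < 7" and rM: "12 < r"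
      and ry: "r dvd ?y k" "r \<le> ?y k"
    then have k: "k \<in> {1, 2, 3, 4, 6, 12}" using ks by blast
    consider "q = 2" using q q7 by linarith
    then show "(?y k ^ cyclotomic_exponent ?D k) ^ 6 * 4 \<le> q ^ 26"
    proof cases
      case 1
      have "?y k ^ cyclotomic_exponent ?D k \<le> 13"
        using k rM ry(2) unfolding 1
        by (elim insertE) (simp_all add: cyclotomic_value_def cyclotomic_exponent_def)
      then show ?thesis by (rule power_times_le_trans) (simp add: 1)
    qed
  qed (simp_all add: power_divide)
qed

lemma power_bound_LieG2:
  assumes q: "q \<ge> 3" and r: "prime r" "\<not> r dvd q"
    and exc: "\<not> lie_exceptional_case LieG2 q r"
    and N: "lie_denominator LieG2 (int q) * int N = lie_numerator LieG2 (int q)"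
    and dvd: "int r ^ v dvd lie_numerator LieG2 (int q)"
  shows "power_bound LieG2 r (r ^ v) N"
proof -
  let ?D = "[2, 6] :: nat list"
  have q2: "q \<ge> 2" using q by simp
  have ks: "k \<in> {1, 2, 3, 6}" if "\<exists>i\<in>set ?D. k dvd i" for k
    using divisor_in_filter[OF that, of 7] by (simp add: upt_rec_numeral del: set_upt set_filter)
  have "int q ^ 6 * int q ^ \<Sum>{2, 6} \<le>
      int q ^ 6 * (2 * (\<Prod>i\<in>{2, 6}. int q ^ i - 1))"
    using q by (intro mult_left_mono prod_power_minus_one_lower) auto
  also have "\<dots> = int (2 * N)" using N by (simp add: mult_ac)
  finally have "int (q ^ 14) \<le> int (2 * N)" by (simp flip: power_add)
  then have lower: "q ^ 14 \<le> 2 * N" by (simp only: of_nat_le_iff)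
  have "int r ^ v dvd (int q ^ 6 - 1) * (int q ^ 2 - 1)"
    by (rule prime_power_dvd_strip[OF r, of v 6]) (use dvd in \<open>simp add: mult_ac\<close>)
  then have dvd': "int r ^ v dvd (\<Prod>i\<leftarrow>?D. int q ^ i - 1)" by (simp add: mult_ac)
  show ?thesis
  proof (rule exceptional_power_bound_numeric[where K = 6 and M = 6 and cA = 3 and cB = 3
        and LL = 2 and a = 2 and b = 1 and e = 0 and f = 0 and C = 3
        and d = 2 and A = "7 / 5", OF q2 q r dvd' lower])
    show "\<forall>i\<in>set ?D. i > 0 \<and> (\<forall>k. k dvd i \<longrightarrow> k \<in> cyclotomic_indices)"
      using ks unfolding cyclotomic_indices_def by auto
  next
    fix k assume "\<exists>i\<in>set ?D. k dvd i"
    then have "k \<in> {1, 2, 3, 6}" by (rule ks)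
    then show "cyclotomic_degree k * cyclotomic_exponent ?D k \<le> 2 \<and>
       (if k = 1 then 1 else if k = 2 then 3 / 2 else 2) ^ cyclotomic_exponent ?D k \<le> real 3 \<and>
       (k = 1 \<or> (7 / 6) ^ cyclotomic_exponent ?D k \<le> (7 / 5 :: real)
         \<or> k = 2 \<and> 10 \<le> (6 :: nat) \<and> (11 / 10) ^ cyclotomic_exponent ?D k \<le> (7 / 5 :: real))"
      by (elim insertE) (simp_all add: cyclotomic_exponent_def cyclotomic_degree_def power_divide)
  next
    let ?y = "\<lambda>k. nat (cyclotomic_value k (int q))"
    fix k assume "\<exists>i\<in>set ?D. k dvd i" and q7: "q < 7" and rM: "6 < r"
      and ry: "r dvd ?y k" "r \<le> ?y k"
    then have k: "k \<in> {1, 2, 3, 6}" using ks by blast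
    note composite = prime_dvd_21_121[OF r(1) ry(1)]
    have excluded: "q = 3 \<Longrightarrow> ?y k \<noteq> 13"
      using primes_dvd_imp_eq[OF r(1), of 13] ry(1) exc
      by (auto simp: lie_exceptional_case_def)
    consider "q = 3" | "q = 4" | "q = 5" | "q = 6" using q q7 by linarith
    then show "(?y k ^ cyclotomic_exponent ?D k) ^ 6 * 2 \<le> q ^ 14"
    proof cases
      case 1
      have "?y k ^ cyclotomic_exponent ?D k \<le> 7"
        using k rM ry(2) composite excluded unfolding 1
        by (elim insertE) (simp_all add: cyclotomic_value_def cyclotomic_exponent_def)
      then show ?thesis by (rule power_times_le_trans) (simp add: 1)
    next
      case 2
      have "?y k ^ cyclotomic_exponent ?D k \<le> 21"
        using k rM ry(2) composite excluded unfolding 2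
        by (elim insertE) (simp_all add: cyclotomic_value_def cyclotomic_exponent_def)
      then show ?thesis by (rule power_times_le_trans) (simp add: 2)
    next
      case 3
      have "?y k ^ cyclotomic_exponent ?D k \<le> 31"
        using k rM ry(2) composite excluded unfolding 3
        by (elim insertE) (simp_all add: cyclotomic_value_def cyclotomic_exponent_def)
      then show ?thesis by (rule power_times_le_trans) (simp add: 3)
    next
      case 4
      have "?y k ^ cyclotomic_exponent ?D k \<le> 49"
        using k rM ry(2) composite excluded unfolding 4
        by (elim insertE) (simp_all add: cyclotomic_value_def cyclotomic_exponent_def)
      then show ?thesis by (rule power_times_le_trans) (simp add: 4)
    qed
  qed (simp_all add: power_divide)
qed

section \<open>The theorem\<close>

lemma sylow_card_prime_power_dvd_numerator:
  assumes "simple_group_with_lie_order X q T" and "prime r" and "sylow_subgroup r R T"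
  obtains v where "card R = r ^ v" "int r ^ v dvd lie_numerator X (int q)" "order T \<ge> 1" "q \<ge> 2"
    "lie_denominator X (int q) * int (order T) = lie_numerator X (int q)" "lie_admissible X q"
proof (rule that)
  have T: "simple_group T" "finite (carrier T)" "primepow q"
    "lie_denominator X (int q) * int (order T) = lie_numerator X (int q)" "lie_admissible X q"
    using assms(1) unfolding simple_group_with_lie_order_def by auto
  show "card R = r ^ multiplicity r (order T)" using assms(3) by (simp add: sylow_subgroup_def)
  have "int (r ^ multiplicity r (order T)) dvd int (order T)"
    by (subst of_nat_dvd_iff) (rule multiplicity_dvd)
  then show "int r ^ multiplicity r (order T) dvd lie_numerator X (int q)"
    unfolding T(4)[symmetric] by simp
  interpret simple_group T by (rule T(1))
  show "order T \<ge> 1" using T(2) order_gt_0_iff_finite by simp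
  show "q \<ge> 2" using primepow_gt_Suc_0[OF T(3)] by simp
qed (use assms(1) in \<open>auto simp: simple_group_with_lie_order_def\<close>)

theorem theorem1p1:
  fixes T :: "('a, 'b) monoid_scheme" and X :: lie_family and q r :: nat and R :: "'a set"
  assumes "simple_group_with_lie_order X q T"
    and "prime r" and "r dvd order T" and "\<not> r dvd q"
    and "sylow_subgroup r R T"
    and "\<not> lie_exceptional_case X q r"
  shows "real (card R) \<le>
    real (order T) powr (real_of_int (\<lfloor>log (real r) (real (lie_M X))\<rfloor> + 1) / lie_K X)"
proof -
  have r: "prime r" "\<not> r dvd q" by fact+
  obtain v where v: "card R = r ^ v" "int r ^ v dvd lie_numerator X (int q)" "order T \<ge> 1" "q \<ge> 2"
    "lie_denominator X (int q) * int (order T) = lie_numerator X (int q)" "lie_admissible X q"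
    using sylow_card_prime_power_dvd_numerator[OF assms(1,2,5)] by blast
  have "power_bound X r (r ^ v) (order T)"
  proof (cases X)
    case (LieA n)
    then show ?thesis using power_bound_LieA[OF v(4) r] v by blast
  next
    case (Tw2A n)
    then show ?thesis using power_bound_Tw2A[OF v(4) r] v by blast
  next
    case (LieB n)
    then show ?thesis using power_bound_LieB_LieC[OF v(4) r _ _ v(5,2), of n] v(6) by simp
  next
    case (LieC n)
    then show ?thesis using power_bound_LieB_LieC[OF v(4) r _ _ v(5,2), of n] v(6) by simp
  next
    case (LieD n)
    then show ?thesis using power_bound_LieD_Tw2D[OF v(4) r _ _ v(5,2), of n "-1"] v(6) by simp
  next
    case (Tw2D n)
    then show ?thesis using power_bound_LieD_Tw2D[OF v(4) r _ _ v(5,2), of n 1] v(6) by simp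
  next
    case Tw2B2
    then show ?thesis using power_bound_Tw2B2[OF r] v by blast
  next
    case Tw3D4
    then show ?thesis using power_bound_Tw3D4[OF v(4) r] assms(6) v by blast
  next
    case LieE6
    then show ?thesis using power_bound_LieE6[OF v(4) r] assms(6) v by blast
  next
    case Tw2E6
    then show ?thesis using power_bound_Tw2E6[OF v(4) r] v by blast
  next
    case LieE7
    then show ?thesis using power_bound_LieE7[OF v(4) r] v by blast
  next
    case LieE8
    then show ?thesis using power_bound_LieE8[OF v(4) r] assms(6) v by blast
  next
    case LieF4
    then show ?thesis using power_bound_LieF4[OF v(4) r] assms(6) v by blast
  next
    case Tw2F4
    then obtain m where m: "q = 2 ^ (2 * m + 1)" using v(6) by auto
    have "q = 2 \<or> q \<ge> 8"
      using m power_increasing[of 3 "2 * m + 1" "2::nat"] by (cases m) auto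
    moreover have "even q" using m by simp
    ultimately show ?thesis using power_bound_Tw2F4[OF _ _ r] Tw2F4 v by blast
  next
    case LieG2
    then show ?thesis using power_bound_LieG2[OF _ r] assms(6) v by (metis lie_admissible.simps(15))
  next
    case Tw2G2
    then show ?thesis using power_bound_Tw2G2[OF r] v by blast
  qed
  then obtain L m p where "m > 0" "p > 0" "lie_K X = real m / real p" "r ^ L \<le> lie_M X"
    "(r ^ v) ^ m \<le> order T ^ (p * (L + 1))"
    unfolding power_bound_def by blast
  then show ?thesis
    unfolding v(1) using prime_ge_2_nat[OF r(1)] v(3) by (intro powr_bound_of_power_bound)
qed

end
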